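(* Let $X$ be a bounded lattice and consider the natural map $\pi:X\to\mathbb{Z}[X]/I$, sending $x$ to its class. Let $Y$ be the Boolean lattice generated by the image of $\pi$. Then \[ \pi^*:\mathcal{M}(Y,-)\to\mathcal{M}(X,-),\qquad \nu\mapsto\nu\circ\pi, \] is a natural isomorphism. In particular, $\mathbb{Z}[X]/I\cong\mathbb{Z}[Y]/I$ as rings, where each $I$ is the ideal attached to the corresponding lattice.
   Context: All rings are commutative with identity. A bounded lattice $X$ has a least element $0_X$ and a greatest element $1_X$ (possibly equal). A Boolean lattice is a bounded, complemented, distributive lattice. For an abelian group $B$, a ($B$-valued) measure on a bounded lattice $X$ is a function $\nu:X\to B$ with $\nu(0_X)=0$ and, for all $k\ge 2$ and all $x_1,\dots,x_k\in X$, \[ \nu(x_1\vee\dots\vee x_k)=\sum_{s=1}^k(-1)^{s+1}\sum_{1\leq i_1<\dots<i_s\leq k}\nu(x_{i_1}\wedge\dots\wedge x_{i_s}). \] $\mathcal{M}(X,B)$ is the abelian group of all $B$-valued measures on $X$; $\mathcal{M}(X,-)$ is a functor from abelian groups to abelian groups, acting on a homomorphism $f:B\to B'$ by $\nu\mapsto f\circ\nu$. For a bounded lattice $X$, $\mathbb{Z}[X]$ is the polynomial ring with one variable for each element of $X$, and $I\subseteq\mathbb{Z}[X]$ is the ideal generated by $0_X$, $1_X-1$, and $x\wedge y-xy$, $x\vee y-x-y+xy$ for all $x,y\in X$. The set $E$ of idempotents of a commutative ring is a Boolean lattice with $x\wedge y:=xy$, $x\vee y:=x+y-xy$, complement $1-x$.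 The elements $\pi(x)$ are idempotents of $\mathbb{Z}[X]/I$, and "the Boolean lattice generated by the image of $\pi$" means the smallest subset of $E\subseteq\mathbb{Z}[X]/I$ containing $\pi(X)$ and closed under $\wedge$, $\vee$ and complement. *)

theory Defs
  imports "HOL-Algebra.QuotRing" "HOL-Algebra.Lattice" "HOL-Algebra.FiniteProduct"
    "HOL-Library.Poly_Mapping"
begin

section \<open>Measures on a bounded lattice\<close>

text \<open>Abelian groups are commutative groups in the sense of HOL-Algebra, hence written
  multiplicatively: the signed sums of the inclusion-exclusion formula become products with
  exponents $\pm 1$. The index tuples $i_1 < \dots < i_s$ are the $s$-element subsets
  of \<open>{1..k}\<close>. Measures are extensional functions, so that equality of measures is
  equality on the lattice.\<close>

definition measures :: "('a, 'm) gorder_scheme \<Rightarrow> ('b, 'n) monoid_scheme \<Rightarrow> ('a \<Rightarrow> 'b) set" where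
  "measures X B =
    {\<nu> \<in> carrier X \<rightarrow>\<^sub>E carrier B.
       \<nu> \<bottom>\<^bsub>X\<^esub> = \<one>\<^bsub>B\<^esub> \<and>
       (\<forall>k::nat. k \<ge> 2 \<longrightarrow> (\<forall>x \<in> {1..k} \<rightarrow> carrier X.
          \<nu> (\<Squnion>\<^bsub>X\<^esub> (x ` {1..k})) =
          (\<Otimes>\<^bsub>B\<^esub>s\<in>{1..k}.
             (\<Otimes>\<^bsub>B\<^esub>A\<in>{A. A \<subseteq> {1..k} \<and> card A = s}. \<nu> (\<Sqinter>\<^bsub>X\<^esub> (x ` A)))
               [^]\<^bsub>B\<^esub> ((- 1) ^ (s + 1) :: int))))}"

definition measure_group :: "('a, 'm) gorder_scheme \<Rightarrow> ('b, 'n) monoid_scheme \<Rightarrow> ('a \<Rightarrow> 'b) monoid"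
  where
  "measure_group X B =
    \<lparr>carrier = measures X B,
     monoid.mult = (\<lambda>\<mu> \<nu>. \<lambda>x\<in>carrier X. \<mu> x \<otimes>\<^bsub>B\<^esub> \<nu> x),
     one = (\<lambda>x\<in>carrier X. \<one>\<^bsub>B\<^esub>)\<rparr>"

definition measure_map :: "('a, 'm) gorder_scheme \<Rightarrow> ('b \<Rightarrow> 'c) \<Rightarrow> ('a \<Rightarrow> 'b) \<Rightarrow> ('a \<Rightarrow> 'c)" where
  "measure_map X f = (\<lambda>\<nu>. compose (carrier X) f \<nu>)"


section \<open>The ring attached to a bounded lattice\<close>

text \<open>A monomial is a finitely supported exponent function \<open>'a \<Rightarrow>\<^sub>0 nat\<close>.\<close>

type_synonym 'a int_mpoly = "('a \<Rightarrow>\<^sub>0 nat) \<Rightarrow>\<^sub>0 int"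

definition int_poly_ring :: "'a set \<Rightarrow> 'a int_mpoly ring" where
  "int_poly_ring V =
    \<lparr>carrier = {p. \<forall>m \<in> Poly_Mapping.keys p. Poly_Mapping.keys m \<subseteq> V}, mult = (*), one = 1, zero = 0, add = (+)\<rparr>"

definition var :: "'a \<Rightarrow> 'a int_mpoly" where
  "var x = Poly_Mapping.single (Poly_Mapping.single x 1) 1"

definition lattice_ideal :: "('a, 'm) gorder_scheme \<Rightarrow> 'a int_mpoly set" where
  "lattice_ideal X =
    Idl\<^bsub>int_poly_ring (carrier X)\<^esub>
      ({var \<bottom>\<^bsub>X\<^esub>, var \<top>\<^bsub>X\<^esub> - 1}
       \<union> {var (x \<sqinter>\<^bsub>X\<^esub> y) - var x * var y | x y. x \<in> carrier X \<and> y \<in> carrier X}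
       \<union> {var (x \<squnion>\<^bsub>X\<^esub> y) - var x - var y + var x * var y | x y. x \<in> carrier X \<and> y \<in> carrier X})"

definition lattice_ring :: "('a, 'm) gorder_scheme \<Rightarrow> 'a int_mpoly set ring" where
  "lattice_ring X = int_poly_ring (carrier X) Quot lattice_ideal X"

definition lattice_class :: "('a, 'm) gorder_scheme \<Rightarrow> 'a \<Rightarrow> 'a int_mpoly set" where
  "lattice_class X x = lattice_ideal X +>\<^bsub>int_poly_ring (carrier X)\<^esub> var x"


section \<open>The Boolean lattice generated by a set of idempotents\<close>

definition idempotents :: "('a, 'm) ring_scheme \<Rightarrow> 'a set" where
  "idempotents R = {e \<in> carrier R. e \<otimes>\<^bsub>R\<^esub> e = e}"

definition bool_closed :: "('a, 'm) ring_scheme \<Rightarrow> 'a set \<Rightarrow> bool" where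
  "bool_closed R S \<longleftrightarrow>
    (\<forall>x\<in>S. \<forall>y\<in>S. x \<otimes>\<^bsub>R\<^esub> y \<in> S) \<and>
    (\<forall>x\<in>S. \<forall>y\<in>S. x \<oplus>\<^bsub>R\<^esub> y \<ominus>\<^bsub>R\<^esub> x \<otimes>\<^bsub>R\<^esub> y \<in> S) \<and>
    (\<forall>x\<in>S. \<one>\<^bsub>R\<^esub> \<ominus>\<^bsub>R\<^esub> x \<in> S)"

text \<open>Lattices in HOL-Algebra are given by their order, here $x \le y$ iff $x \wedge y = x$.\<close>

definition generated_boolean_lattice :: "('a, 'm) ring_scheme \<Rightarrow> 'a set \<Rightarrow> 'a gorder" where
  "generated_boolean_lattice R A =
    \<lparr>carrier = \<Inter>{S. A \<subseteq> S \<and> S \<subseteq> idempotents R \<and> bool_closed R S},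
     eq = (=),
     le = (\<lambda>x y. x \<otimes>\<^bsub>R\<^esub> y = x)\<rparr>"

definition boolean_envelope :: "('a, 'm) gorder_scheme \<Rightarrow> 'a int_mpoly set gorder" where
  "boolean_envelope X = generated_boolean_lattice (lattice_ring X) (lattice_class X ` carrier X)"

definition pi_pullback :: "('a, 'm) gorder_scheme \<Rightarrow> ('a int_mpoly set \<Rightarrow> 'b) \<Rightarrow> ('a \<Rightarrow> 'b)" where
  "pi_pullback X = (\<lambda>\<nu>. compose (carrier X) \<nu> (lattice_class X))"


section \<open>Consistency of the definitions\<close>

subsection \<open>The ring attached to a bounded lattice\<close>

lemma int_poly_ring_carrier_minus:
  "p \<in> carrier (int_poly_ring V) \<Longrightarrow> - p \<in> carrier (int_poly_ring V)"
  by (auto simp: int_poly_ring_def)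

lemma int_poly_ring_carrier_mult:
  assumes "p \<in> carrier (int_poly_ring V)" "q \<in> carrier (int_poly_ring V)"
  shows "p * q \<in> carrier (int_poly_ring V)"
proof -
  have "Poly_Mapping.keys m \<subseteq> V" if m: "m \<in> Poly_Mapping.keys (p * q)" for m
  proof -
    obtain a b where "m = a + b" "a \<in> Poly_Mapping.keys p" "b \<in> Poly_Mapping.keys q"
      using m keys_mult[of p q] by blast
    then show ?thesis
      using assms keys_add[of a b] by (fastforce simp: int_poly_ring_def)
  qed
  then show ?thesis by (simp add: int_poly_ring_def)
qed

lemma int_poly_ring_cring: "cring (int_poly_ring V)"
proof (rule cringI)
  show "abelian_group (int_poly_ring V)"
  proof (rule abelian_groupI)
    fix x y assume "x \<in> carrier (int_poly_ring V)" "y \<in> carrier (int_poly_ring V)"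
    then show "x \<oplus>\<^bsub>int_poly_ring V\<^esub> y \<in> carrier (int_poly_ring V)"
      using keys_add[of x y] by (fastforce simp: int_poly_ring_def)
  next
    fix x assume "x \<in> carrier (int_poly_ring V)"
    then show "\<exists>y\<in>carrier (int_poly_ring V). y \<oplus>\<^bsub>int_poly_ring V\<^esub> x = \<zero>\<^bsub>int_poly_ring V\<^esub>"
      by (intro bexI[of _ "- x"] int_poly_ring_carrier_minus) (simp_all add: int_poly_ring_def)
  qed (auto simp: int_poly_ring_def add_ac)
  show "comm_monoid (int_poly_ring V)"
  proof (rule comm_monoidI)
    fix x y assume "x \<in> carrier (int_poly_ring V)" "y \<in> carrier (int_poly_ring V)"
    then show "x \<otimes>\<^bsub>int_poly_ring V\<^esub> y \<in> carrier (int_poly_ring V)"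
      using int_poly_ring_carrier_mult[of x V y] by (simp add: int_poly_ring_def)
  qed (simp_all add: int_poly_ring_def mult_ac)
qed (simp add: int_poly_ring_def algebra_simps)

lemma int_poly_ring_minus:
  assumes "p \<in> carrier (int_poly_ring V)" "q \<in> carrier (int_poly_ring V)"
  shows "p \<ominus>\<^bsub>int_poly_ring V\<^esub> q = p - q"
proof -
  interpret cring "int_poly_ring V" by (rule int_poly_ring_cring)
  have "\<ominus>\<^bsub>int_poly_ring V\<^esub> q = - q"
    using assms int_poly_ring_carrier_minus[OF assms(2)]
    by (intro minus_equality) (simp_all add: int_poly_ring_def)
  then show ?thesis by (simp add: a_minus_def int_poly_ring_def)
qed

lemma int_poly_ring_carrier_diff:
  assumes "p \<in> carrier (int_poly_ring V)" "q \<in> carrier (int_poly_ring V)"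
  shows "p - q \<in> carrier (int_poly_ring V)"
proof -
  interpret cring "int_poly_ring V" by (rule int_poly_ring_cring)
  show ?thesis using minus_closed[OF assms] int_poly_ring_minus[OF assms] by simp
qed

lemma var_carrier: "x \<in> V \<Longrightarrow> var x \<in> carrier (int_poly_ring V)"
  by (simp add: int_poly_ring_def var_def)

lemma lattice_ideal_generators:
  assumes "bounded_lattice X"
  shows "{var \<bottom>\<^bsub>X\<^esub>, var \<top>\<^bsub>X\<^esub> - 1}
       \<union> {var (x \<sqinter>\<^bsub>X\<^esub> y) - var x * var y | x y. x \<in> carrier X \<and> y \<in> carrier X}
       \<union> {var (x \<squnion>\<^bsub>X\<^esub> y) - var x - var y + var x * var y | x y. x \<in> carrier X \<and> y \<in> carrier X}
       \<subseteq> carrier (int_poly_ring (carrier X))" (is "?S \<subseteq> carrier ?R")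
proof -
  interpret bounded_lattice X by fact
  interpret R: cring ?R by (rule int_poly_ring_cring)
  have add: "p + q \<in> carrier ?R" if "p \<in> carrier ?R" "q \<in> carrier ?R" for p q
    using R.a_closed[OF that] by (simp add: int_poly_ring_def)
  have one: "1 \<in> carrier ?R" using R.one_closed by (simp add: int_poly_ring_def)
  show ?thesis
    by (auto intro!: add one int_poly_ring_carrier_diff int_poly_ring_carrier_mult var_carrier)
qed

lemma lattice_ideal_ideal:
  assumes "bounded_lattice X"
  shows "ideal (lattice_ideal X) (int_poly_ring (carrier X))"
  unfolding lattice_ideal_def
  by (rule ring.genideal_ideal[OF cring.axioms(1)[OF int_poly_ring_cring]
        lattice_ideal_generators[OF assms]])

lemma lattice_ring_cring: "bounded_lattice X \<Longrightarrow> cring (lattice_ring X)"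
  unfolding lattice_ring_def
  by (rule ideal.quotient_is_cring[OF lattice_ideal_ideal int_poly_ring_cring])

lemma lattice_class_idempotent:
  assumes "bounded_lattice X" "x \<in> carrier X"
  shows "lattice_class X x \<in> idempotents (lattice_ring X)"
proof -
  let ?R = "int_poly_ring (carrier X)"
  interpret bounded_lattice X by fact
  interpret R: cring ?R by (rule int_poly_ring_cring)
  interpret I: ideal "lattice_ideal X" ?R by (rule lattice_ideal_ideal[OF assms(1)])
  have v: "var x \<in> carrier ?R" "var x * var x \<in> carrier ?R"
    using assms by (auto intro: var_carrier int_poly_ring_carrier_mult)
  have xx: "x \<sqinter>\<^bsub>X\<^esub> x = x"
    using assms(2) meet_le meet_left le_refl by (meson le_antisym meet_closed)
  have "var (x \<sqinter>\<^bsub>X\<^esub> x) - var x * var x \<in> lattice_ideal X"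
    unfolding lattice_ideal_def
    using R.genideal_self[OF lattice_ideal_generators[OF assms(1)]] assms(2) by blast
  then have "var x \<ominus>\<^bsub>?R\<^esub> var x * var x \<in> lattice_ideal X"
    using v by (simp add: xx int_poly_ring_minus)
  then have "lattice_ideal X +>\<^bsub>?R\<^esub> var x = lattice_ideal X +>\<^bsub>?R\<^esub> (var x * var x)"
    using v R.quotient_eq_iff_same_a_r_cos[OF I.ideal_axioms] by blast
  moreover have "[mod lattice_ideal X:] (lattice_ideal X +>\<^bsub>?R\<^esub> var x) \<Otimes>\<^bsub>?R\<^esub> (lattice_ideal X +>\<^bsub>?R\<^esub> var x)
      = lattice_ideal X +>\<^bsub>?R\<^esub> (var x \<otimes>\<^bsub>?R\<^esub> var x)"
    using I.rcoset_mult_add[OF v(1) v(1)] .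
  moreover have "var x \<otimes>\<^bsub>?R\<^esub> var x = var x * var x" by (simp add: int_poly_ring_def)
  moreover have "lattice_ideal X +>\<^bsub>?R\<^esub> var x \<in> a_rcosets\<^bsub>?R\<^esub> (lattice_ideal X)"
    by (rule R.a_rcosetsI[OF I.a_subset v(1)])
  ultimately show ?thesis
    by (simp add: idempotents_def lattice_ring_def lattice_class_def FactRing_def)
qed

subsection \<open>The generated Boolean lattice\<close>

context cring
begin

lemma idempotents_bool_closed: "bool_closed R (idempotents R)"
  unfolding bool_closed_def
proof (intro conjI ballI)
  fix x y assume xy: "x \<in> idempotents R" "y \<in> idempotents R"
  then have [simp]: "x \<in> carrier R" "y \<in> carrier R" and i: "x \<otimes> x = x" "y \<otimes> y = y"
    by (auto simp: idempotents_def)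
  have xyxy: "(x \<otimes> y) \<otimes> (x \<otimes> y) = x \<otimes> y"
    using i by (metis \<open>x \<in> carrier R\<close> \<open>y \<in> carrier R\<close> m_assoc m_comm m_closed)
  then show "x \<otimes> y \<in> idempotents R" by (simp add: idempotents_def)
  have 1: "(\<one> \<ominus> e) \<otimes> (\<one> \<ominus> e) = \<one> \<ominus> e" if "e \<in> carrier R" "e \<otimes> e = e" for e
  proof -
    have "(\<one> \<ominus> e) \<otimes> (\<one> \<ominus> e) = \<one> \<ominus> e \<ominus> e \<oplus> e \<otimes> e" using that(1) by algebra
    also have "\<dots> = \<one> \<ominus> e \<ominus> e \<oplus> e" using that(2) by simp
    also have "\<dots> = \<one> \<ominus> e" using that(1) by algebra
    finally show ?thesis .
  qed
  have x': "x \<otimes> (x \<otimes> y) = x \<otimes> y" "y \<otimes> (x \<otimes> y) = x \<otimes> y"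
    using i by (metis \<open>x \<in> carrier R\<close> \<open>y \<in> carrier R\<close> m_assoc m_comm)+
  have "(x \<oplus> y \<ominus> x \<otimes> y) \<otimes> (x \<oplus> y \<ominus> x \<otimes> y) =
      x \<otimes> x \<oplus> y \<otimes> y \<oplus> x \<otimes> y \<oplus> x \<otimes> y \<ominus> x \<otimes> (x \<otimes> y) \<ominus> x \<otimes> (x \<otimes> y)
      \<ominus> y \<otimes> (x \<otimes> y) \<ominus> y \<otimes> (x \<otimes> y) \<oplus> (x \<otimes> y) \<otimes> (x \<otimes> y)"
    using \<open>x \<in> carrier R\<close> \<open>y \<in> carrier R\<close> by algebra
  also have "\<dots> = x \<oplus> y \<oplus> x \<otimes> y \<oplus> x \<otimes> y \<ominus> x \<otimes> y \<ominus> x \<otimes> y \<ominus> x \<otimes> y \<ominus> x \<otimes> y \<oplus> x \<otimes> y"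
    by (simp only: i x' xyxy)
  also have "\<dots> = x \<oplus> y \<ominus> x \<otimes> y"
    using \<open>x \<in> carrier R\<close> \<open>y \<in> carrier R\<close> by algebra
  finally show "x \<oplus> y \<ominus> x \<otimes> y \<in> idempotents R" by (simp add: idempotents_def)
  show "\<one> \<ominus> x \<in> idempotents R" using 1[of x] i by (simp add: idempotents_def)
qed

context
  fixes A Y
  assumes A: "A \<subseteq> idempotents R" "A \<noteq> {}"
  defines "Y \<equiv> generated_boolean_lattice R A"
begin

lemma generated_incl: "A \<subseteq> carrier Y"
  by (auto simp: Y_def generated_boolean_lattice_def)

lemma generated_idempotent: "carrier Y \<subseteq> idempotents R"
  using A idempotents_bool_closed by (auto simp: Y_def generated_boolean_lattice_def)

lemma generated_bool_closed: "bool_closed R (carrier Y)"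
  by (auto simp: Y_def generated_boolean_lattice_def bool_closed_def)

lemma generated_closed:
  assumes "x \<in> carrier Y" "y \<in> carrier Y"
  shows "x \<otimes> y \<in> carrier Y" "x \<oplus> y \<ominus> x \<otimes> y \<in> carrier Y" "\<one> \<ominus> x \<in> carrier Y"
  using generated_bool_closed assms by (auto simp: bool_closed_def)

lemma generated_carrier:
  assumes "x \<in> carrier Y" shows "x \<in> carrier R" "x \<otimes> x = x"
  using generated_idempotent assms by (auto simp: idempotents_def)

lemma generated_zero_one: "\<zero> \<in> carrier Y" "\<one> \<in> carrier Y"
proof -
  obtain a where a: "a \<in> carrier Y" using A generated_incl by blast
  have "a \<otimes> (\<one> \<ominus> a) = a \<ominus> a \<otimes> a" using generated_carrier(1)[OF a] by algebra
  also have "\<dots> = \<zero>" using generated_carrier[OF a] by (simp add: r_neg a_minus_def)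
  finally show 0: "\<zero> \<in> carrier Y" using generated_closed(1)[OF a generated_closed(3)[OF a a]] by simp
  show "\<one> \<in> carrier Y" using generated_closed(3)[OF 0 0] by (simp add: a_minus_def)
qed

lemma generated_le: "x \<sqsubseteq>\<^bsub>Y\<^esub> y \<longleftrightarrow> x \<otimes> y = x"
  by (simp add: Y_def generated_boolean_lattice_def)

lemma generated_partial_order: "partial_order Y"
proof
  show "(.=\<^bsub>Y\<^esub>) = (=)" by (simp add: Y_def generated_boolean_lattice_def)
next
  fix x y z assume "x \<sqsubseteq>\<^bsub>Y\<^esub> y" "y \<sqsubseteq>\<^bsub>Y\<^esub> z" "x \<in> carrier Y" "y \<in> carrier Y" "z \<in> carrier Y"
  then show "x \<sqsubseteq>\<^bsub>Y\<^esub> z" unfolding generated_le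
    by (metis generated_carrier(1) m_assoc)
qed (use generated_carrier m_comm in
     \<open>auto simp: generated_le, auto simp: Y_def generated_boolean_lattice_def\<close>)

lemma generated_meet_greatest:
  assumes "x \<in> carrier Y" "y \<in> carrier Y"
  shows "greatest Y (x \<otimes> y) (Lower Y {x, y})"
proof -
  note c = generated_carrier[OF assms(1)] generated_carrier[OF assms(2)]
  have "x \<otimes> y \<otimes> x = x \<otimes> y" "x \<otimes> y \<otimes> y = x \<otimes> y"
    using c by (metis m_assoc m_comm)+
  moreover have "z \<otimes> (x \<otimes> y) = z" if "z \<in> carrier Y" "z \<otimes> x = z" "z \<otimes> y = z" for z
    using that c generated_carrier[of z] by (metis m_assoc)
  ultimately show ?thesis
    using assms generated_closed(1)[OF assms] by (auto simp: greatest_def Lower_def generated_le)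
qed

lemma generated_join_least:
  assumes "x \<in> carrier Y" "y \<in> carrier Y"
  shows "least Y (x \<oplus> y \<ominus> x \<otimes> y) (Upper Y {x, y})"
proof -
  note c = generated_carrier[OF assms(1)] generated_carrier[OF assms(2)]
  have "x \<otimes> (x \<oplus> y \<ominus> x \<otimes> y) = x \<otimes> x \<oplus> x \<otimes> y \<ominus> (x \<otimes> x) \<otimes> y" using c(1,3) by algebra
  also have "\<dots> = x \<oplus> x \<otimes> y \<ominus> x \<otimes> y" using c by simp
  also have "\<dots> = x" using c(1,3) by algebra
  finally have 1: "x \<otimes> (x \<oplus> y \<ominus> x \<otimes> y) = x" .
  have "y \<otimes> (x \<oplus> y \<ominus> x \<otimes> y) = y \<otimes> y \<oplus> x \<otimes> y \<ominus> x \<otimes> (y \<otimes> y)" using c(1,3) by algebra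
  also have "\<dots> = y \<oplus> x \<otimes> y \<ominus> x \<otimes> y" using c by simp
  also have "\<dots> = y" using c(1,3) by algebra
  finally have 2: "y \<otimes> (x \<oplus> y \<ominus> x \<otimes> y) = y" .
  have 3: "(x \<oplus> y \<ominus> x \<otimes> y) \<otimes> z = x \<oplus> y \<ominus> x \<otimes> y"
    if "z \<in> carrier Y" "x \<otimes> z = x" "y \<otimes> z = y" for z
  proof -
    have "(x \<oplus> y \<ominus> x \<otimes> y) \<otimes> z = x \<otimes> z \<oplus> y \<otimes> z \<ominus> x \<otimes> (y \<otimes> z)"
      using c(1,3) generated_carrier(1)[OF that(1)] by algebra
    then show ?thesis using that by simp
  qed
  show ?thesis
    using 1 2 3 assms generated_closed(2)[OF assms] by (auto simp: least_def Upper_def generated_le)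
qed

lemma generated_bottom_least: "least Y \<zero> (carrier Y)"
  using generated_zero_one generated_carrier by (auto simp: least_def generated_le)

lemma generated_top_greatest: "greatest Y \<one> (carrier Y)"
  using generated_zero_one generated_carrier by (auto simp: greatest_def generated_le)

lemma generated_bounded_lattice: "bounded_lattice Y"
proof -
  interpret partial_order Y by (rule generated_partial_order)
  show ?thesis
    by unfold_locales
      (use generated_meet_greatest generated_join_least generated_bottom_least
        generated_top_greatest in blast)+
qed

lemma generated_meet: "x \<in> carrier Y \<Longrightarrow> y \<in> carrier Y \<Longrightarrow> x \<sqinter>\<^bsub>Y\<^esub> y = x \<otimes> y"
proof -
  interpret Y: bounded_lattice Y by (rule generated_bounded_lattice)
  show "x \<in> carrier Y \<Longrightarrow> y \<in> carrier Y \<Longrightarrow> x \<sqinter>\<^bsub>Y\<^esub> y = x \<otimes> y"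
    by (metis Y.greatest_unique Y.inf_of_two_greatest generated_meet_greatest meet_def)
qed

lemma generated_join: "x \<in> carrier Y \<Longrightarrow> y \<in> carrier Y \<Longrightarrow> x \<squnion>\<^bsub>Y\<^esub> y = x \<oplus> y \<ominus> x \<otimes> y"
proof -
  interpret Y: bounded_lattice Y by (rule generated_bounded_lattice)
  show "x \<in> carrier Y \<Longrightarrow> y \<in> carrier Y \<Longrightarrow> x \<squnion>\<^bsub>Y\<^esub> y = x \<oplus> y \<ominus> x \<otimes> y"
    by (metis Y.least_unique Y.sup_of_two_least generated_join_least join_def)
qed

lemma generated_bottom: "\<bottom>\<^bsub>Y\<^esub> = \<zero>"
proof -
  interpret Y: bounded_lattice Y by (rule generated_bounded_lattice)
  show ?thesis by (metis Y.least_unique Y.bottom_least generated_bottom_least)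
qed

lemma generated_top: "\<top>\<^bsub>Y\<^esub> = \<one>"
proof -
  interpret Y: bounded_lattice Y by (rule generated_bounded_lattice)
  show ?thesis by (metis Y.greatest_unique Y.top_greatest generated_top_greatest)
qed

end

end

theorem boolean_envelope_lattice:
  assumes "bounded_lattice X"
  defines "R \<equiv> lattice_ring X" and "Y \<equiv> boolean_envelope X"
  shows "bounded_lattice Y"
    and "lattice_class X \<in> carrier X \<rightarrow> carrier Y"
    and "\<bottom>\<^bsub>Y\<^esub> = \<zero>\<^bsub>R\<^esub>" and "\<top>\<^bsub>Y\<^esub> = \<one>\<^bsub>R\<^esub>"
    and "\<And>x y. x \<in> carrier Y \<Longrightarrow> y \<in> carrier Y \<Longrightarrow> x \<sqinter>\<^bsub>Y\<^esub> y = x \<otimes>\<^bsub>R\<^esub> y"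
    and "\<And>x y. x \<in> carrier Y \<Longrightarrow> y \<in> carrier Y \<Longrightarrow> x \<squnion>\<^bsub>Y\<^esub> y = x \<oplus>\<^bsub>R\<^esub> y \<ominus>\<^bsub>R\<^esub> x \<otimes>\<^bsub>R\<^esub> y"
proof -
  interpret X: bounded_lattice X by fact
  interpret R: cring R unfolding R_def by (rule lattice_ring_cring[OF assms(1)])
  have A: "lattice_class X ` carrier X \<subseteq> idempotents R" "lattice_class X ` carrier X \<noteq> {}"
    using lattice_class_idempotent[OF assms(1)] X.bottom_closed by (auto simp: R_def)
  note Y = Y_def[unfolded boolean_envelope_def, folded R_def]
  show "bounded_lattice Y" unfolding Y by (rule R.generated_bounded_lattice[OF A])
  show "lattice_class X \<in> carrier X \<rightarrow> carrier Y" using R.generated_incl[OF A] unfolding Y by blast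
  show "\<bottom>\<^bsub>Y\<^esub> = \<zero>\<^bsub>R\<^esub>" unfolding Y by (rule R.generated_bottom[OF A])
  show "\<top>\<^bsub>Y\<^esub> = \<one>\<^bsub>R\<^esub>" unfolding Y by (rule R.generated_top[OF A])
  show "x \<sqinter>\<^bsub>Y\<^esub> y = x \<otimes>\<^bsub>R\<^esub> y" if "x \<in> carrier Y" "y \<in> carrier Y" for x y
    using that unfolding Y by (rule R.generated_meet[OF A])
  show "x \<squnion>\<^bsub>Y\<^esub> y = x \<oplus>\<^bsub>R\<^esub> y \<ominus>\<^bsub>R\<^esub> x \<otimes>\<^bsub>R\<^esub> y" if "x \<in> carrier Y" "y \<in> carrier Y" for x y
    using that unfolding Y by (rule R.generated_join[OF A])
qed

end

theory Submission
  imports Defs "HOL-Algebra.Multiplicative_Group"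
begin

text \<open>Inclusion-exclusion for three elements, compared with two applications of it for two, gives
  \<open>\<nu> (z \<sqinter> (x \<squnion> y)) = \<nu> (z \<sqinter> x) + \<nu> (z \<sqinter> y) - \<nu> (z \<sqinter> x \<sqinter> y)\<close>, and this law implies
  inclusion-exclusion in general. It also says that the additive map on polynomials sending a monomial
  to the value of \<open>\<nu>\<close> at the meet of its variables kills the ideal, so measures on \<open>X\<close> are the same
  as additive maps on the lattice ring of \<open>X\<close>. Ring homomorphisms out of the lattice ring arise in the
  same way, from measures with values in the additive group of a ring. The inclusion of \<open>Y\<close> into the
  ring of \<open>X\<close> thus induces a homomorphism from the ring of \<open>Y\<close> to the ring of \<open>X\<close>. Its inverse sends
  \<open>\<pi> x\<close> to the class of \<open>\<pi> x\<close>; it sends every element of \<open>Y\<close> to its class, because the elements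
  for which this holds are closed under the Boolean operations.\<close>

subsection \<open>Finite meets and joins\<close>

context bounded_lattice
begin

lemma meet_assoc:
  assumes "x \<in> carrier L" "y \<in> carrier L" "z \<in> carrier L"
  shows "x \<sqinter> y \<sqinter> z = x \<sqinter> (y \<sqinter> z)"
  using weak_meet_assoc[OF assms] by (simp add: eq_is_equal)

lemma meet_top: "x \<in> carrier L \<Longrightarrow> \<top> \<sqinter> x = x"
  using top_meet by (simp add: eq_is_equal)

lemma meet_bottom: "x \<in> carrier L \<Longrightarrow> x \<sqinter> \<bottom> = \<bottom>"
  using bottom_meet by (simp add: eq_is_equal meet_comm)

lemma join_bottom: "x \<in> carrier L \<Longrightarrow> x \<squnion> \<bottom> = x"
  using bottom_join by (simp add: eq_is_equal join_comm)

text \<open>The empty set is included, its meet being the top element: the monomial 1 has no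
  variables and is to receive the value at \<open>\<top>\<close>.\<close>

lemma finite_inf_greatest':
  assumes "finite A" "A \<subseteq> carrier L"
  shows "greatest L (\<Sqinter>A) (Lower L A)"
proof (cases "A = {}")
  case True
  then show ?thesis using top_greatest by (simp add: inf_def top_def someI[of _ \<top>])
qed (use assms finite_inf_greatest in auto)

lemma finite_sup_least':
  assumes "finite A" "A \<subseteq> carrier L"
  shows "least L (\<Squnion>A) (Upper L A)"
proof (cases "A = {}")
  case True
  then show ?thesis using bottom_least by (simp add: sup_def bottom_def someI[of _ \<bottom>])
qed (use assms finite_sup_least in auto)

lemma finite_inf_closed': "finite A \<Longrightarrow> A \<subseteq> carrier L \<Longrightarrow> \<Sqinter>A \<in> carrier L"
  using finite_inf_greatest' greatest_closed by blast

lemma finite_sup_closed': "finite A \<Longrightarrow> A \<subseteq> carrier L \<Longrightarrow> \<Squnion>A \<in> carrier L"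
  using finite_sup_least' least_closed by blast

lemma inf_empty: "\<Sqinter>{} = \<top>"
  by (simp add: inf_def top_def)

lemma sup_empty: "\<Squnion>{} = \<bottom>"
  by (simp add: sup_def bottom_def)

lemma inf_singleton: "x \<in> carrier L \<Longrightarrow> \<Sqinter>{x} = x"
  using weak_inf_of_singleton by (simp add: eq_is_equal)

lemma finite_inf_Un:
  assumes "finite A" "A \<subseteq> carrier L" "finite B" "B \<subseteq> carrier L"
  shows "\<Sqinter>(A \<union> B) = \<Sqinter>A \<sqinter> \<Sqinter>B"
proof -
  note A = finite_inf_greatest'[OF assms(1,2)] and B = finite_inf_greatest'[OF assms(3,4)]
  note c = finite_inf_closed'[OF assms(1,2)] finite_inf_closed'[OF assms(3,4)]
  have AB: "greatest L (\<Sqinter>(A \<union> B)) (Lower L (A \<union> B))"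
    using assms by (intro finite_inf_greatest') auto
  have "\<Sqinter>A \<sqinter> \<Sqinter>B \<sqsubseteq> u" if "u \<in> A \<union> B" for u
  proof -
    have u: "u \<in> carrier L" using that assms by blast
    have "\<Sqinter>A \<sqsubseteq> u \<or> \<Sqinter>B \<sqsubseteq> u"
      using that A B u by (auto simp: greatest_def Lower_def)
    then show ?thesis
      using c u meet_left meet_right le_trans meet_closed by meson
  qed
  then have 1: "\<Sqinter>A \<sqinter> \<Sqinter>B \<sqsubseteq> \<Sqinter>(A \<union> B)"
    using AB c by (auto simp: greatest_def Lower_def)
  have "\<Sqinter>(A \<union> B) \<sqsubseteq> \<Sqinter>A" "\<Sqinter>(A \<union> B) \<sqsubseteq> \<Sqinter>B"
    using AB A B by (auto simp: greatest_def Lower_def)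
  then have 2: "\<Sqinter>(A \<union> B) \<sqsubseteq> \<Sqinter>A \<sqinter> \<Sqinter>B"
    using meet_le c AB greatest_closed by blast
  show ?thesis using 1 2 c AB greatest_closed by (intro le_antisym) auto
qed

lemma finite_inf_insert:
  assumes "finite A" "A \<subseteq> carrier L" "x \<in> carrier L"
  shows "\<Sqinter>(insert x A) = x \<sqinter> \<Sqinter>A"
  using finite_inf_Un[of "{x}" A] assms by (simp add: inf_singleton)

lemma finite_sup_insert:
  assumes "finite A" "A \<subseteq> carrier L" "x \<in> carrier L"
  shows "\<Squnion>(insert x A) = x \<squnion> \<Squnion>A"
proof -
  note A = finite_sup_least'[OF assms(1,2)] and c = finite_sup_closed'[OF assms(1,2)]
  have xA: "least L (\<Squnion>(insert x A)) (Upper L (insert x A))"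
    using assms by (intro finite_sup_least') auto
  have "u \<sqsubseteq> x \<squnion> \<Squnion>A" if "u \<in> insert x A" for u
  proof -
    have u: "u \<in> carrier L" using that assms by blast
    have "u = x \<or> u \<sqsubseteq> \<Squnion>A"
      using that A u by (auto simp: least_def Upper_def)
    then show ?thesis
      using c u assms join_left join_right le_trans join_closed by meson
  qed
  then have 1: "\<Squnion>(insert x A) \<sqsubseteq> x \<squnion> \<Squnion>A"
    using xA c assms by (auto simp: least_def Upper_def)
  have "x \<sqsubseteq> \<Squnion>(insert x A)" "\<Squnion>A \<sqsubseteq> \<Squnion>(insert x A)"
    using xA A assms by (auto simp: least_def Upper_def)
  then have 2: "x \<squnion> \<Squnion>A \<sqsubseteq> \<Squnion>(insert x A)"
    using join_le c xA least_closed assms by blast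
  show ?thesis using 1 2 c xA least_closed assms by (intro le_antisym) auto
qed

end

subsection \<open>Measures and the distributive modular law\<close>

text \<open>The case \<open>z = \<top>\<close> is the modular law. On a non-distributive lattice the
  general \<open>z\<close> is a genuine extra condition, which inclusion-exclusion for three
  elements supplies.\<close>

definition modular_measure :: "('a, 'm) gorder_scheme \<Rightarrow> ('b, 'n) monoid_scheme \<Rightarrow> ('a \<Rightarrow> 'b) \<Rightarrow> bool"
  where
  "modular_measure X B \<nu> \<longleftrightarrow>
    \<nu> \<in> carrier X \<rightarrow> carrier B \<and> \<nu> \<bottom>\<^bsub>X\<^esub> = \<one>\<^bsub>B\<^esub> \<and>
    (\<forall>x\<in>carrier X. \<forall>y\<in>carrier X. \<forall>z\<in>carrier X.
       \<nu> (z \<sqinter>\<^bsub>X\<^esub> (x \<squnion>\<^bsub>X\<^esub> y)) =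
       \<nu> (z \<sqinter>\<^bsub>X\<^esub> x) \<otimes>\<^bsub>B\<^esub> \<nu> (z \<sqinter>\<^bsub>X\<^esub> y) \<otimes>\<^bsub>B\<^esub> inv\<^bsub>B\<^esub> \<nu> (z \<sqinter>\<^bsub>X\<^esub> (x \<sqinter>\<^bsub>X\<^esub> y)))"

text \<open>The cut-off \<open>z\<close> makes the sum recursive in \<open>J\<close>: removing an
  index \<open>j\<close> leads to the same sum with \<open>z \<sqinter> x j\<close> in place of
  \<open>z\<close>. At \<open>z = \<top>\<close> it is the usual right-hand side.\<close>

definition incl_excl ::
    "('a, 'm) gorder_scheme \<Rightarrow> ('b, 'n) monoid_scheme \<Rightarrow> ('a \<Rightarrow> 'b) \<Rightarrow> ('i \<Rightarrow> 'a) \<Rightarrow> 'i set \<Rightarrow> 'a \<Rightarrow> 'b"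
  where
  "incl_excl X B \<nu> x J z =
    (\<Otimes>\<^bsub>B\<^esub>A\<in>Pow J - {{}}. \<nu> (z \<sqinter>\<^bsub>X\<^esub> \<Sqinter>\<^bsub>X\<^esub> (x ` A)) [^]\<^bsub>B\<^esub> ((- 1) ^ (card A + 1) :: int))"

section \<open>Inclusion-exclusion with values in an abelian group\<close>

context comm_group
begin

lemma finprod_int_pow:
  assumes "finite A" "f \<in> A \<rightarrow> carrier G"
  shows "finprod G f A [^] (c::int) = (\<Otimes>a\<in>A. f a [^] c)"
  using assms by (induction A rule: finite_induct) (simp_all add: int_pow_distrib Pi_def)

lemma finprod_inv:
  assumes "finite A" "f \<in> A \<rightarrow> carrier G"
  shows "inv finprod G f A = (\<Otimes>a\<in>A. inv f a)"
  using assms by (induction A rule: finite_induct) (simp_all add: inv_mult Pi_def)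

lemma incl_excl_closed:
  assumes "bounded_lattice X" "\<nu> \<in> carrier X \<rightarrow> carrier G" "finite J" "x \<in> J \<rightarrow> carrier X" "z \<in> carrier X"
  shows "incl_excl X G \<nu> x J z \<in> carrier G"
proof -
  interpret X: bounded_lattice X by fact
  have "\<Sqinter>\<^bsub>X\<^esub> (x ` A) \<in> carrier X" if "A \<subseteq> J" for A
    using that assms finite_subset[of A J] by (intro X.finite_inf_closed') (auto simp: Pi_def)
  then show ?thesis
    unfolding incl_excl_def using assms(2,5)
    by (intro finprod_closed) (auto simp: Pi_def)
qed

lemma incl_excl_empty: "incl_excl X G \<nu> x {} z = \<one>"
  by (simp add: incl_excl_def)

text \<open>A nonempty subset of \<open>insert j J\<close> is \<open>{j}\<close>, or avoids
  \<open>j\<close>, or is \<open>insert j A\<close> with \<open>A \<subseteq> J\<close> nonempty. In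
  the last case the size exceeds that of \<open>A\<close> by one, which inverts the factor, and
  \<open>x j\<close> is absorbed into \<open>z\<close>.\<close>

lemma incl_excl_insert:
  assumes "bounded_lattice X" and \<nu>: "\<nu> \<in> carrier X \<rightarrow> carrier G"
    and J: "finite J" "j \<notin> J" and x: "x \<in> insert j J \<rightarrow> carrier X" and z: "z \<in> carrier X"
  shows "incl_excl X G \<nu> x (insert j J) z =
    \<nu> (z \<sqinter>\<^bsub>X\<^esub> x j) \<otimes> incl_excl X G \<nu> x J z \<otimes> inv incl_excl X G \<nu> x J (z \<sqinter>\<^bsub>X\<^esub> x j)"
proof -
  interpret X: bounded_lattice X by fact
  let ?P = "Pow J - {{}}"
  define g where "g z A = \<nu> (z \<sqinter>\<^bsub>X\<^esub> \<Sqinter>\<^bsub>X\<^esub> (x ` A)) [^] ((- 1) ^ (card A + 1) :: int)" for z A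
  have fin: "finite A" if "A \<subseteq> J" for A using that J finite_subset by blast
  have xA: "x ` A \<subseteq> carrier X" if "A \<subseteq> J" for A
    using x that by (auto simp: Pi_def)
  have xj: "x j \<in> carrier X" using x by auto
  have inf: "\<Sqinter>\<^bsub>X\<^esub> (x ` A) \<in> carrier X" if "A \<subseteq> insert j J" for A
    using that J x finite_subset[of A "insert j J"] by (intro X.finite_inf_closed') (auto simp: Pi_def)
  have g: "g z A \<in> carrier G" if "A \<subseteq> insert j J" "z \<in> carrier X" for A z
    using inf[OF that(1)] that(2) \<nu> by (auto simp: g_def Pi_def)
  have g': "g z A \<in> carrier G" "g z (insert j A) \<in> carrier G" if "A \<subseteq> J" "z \<in> carrier X" for A z
    using that g[of A z] g[of "insert j A" z] by auto
  have split: "Pow (insert j J) - {{}} = insert {j} (?P \<union> insert j ` ?P)"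
    by (auto simp: Pow_insert)
  have inj: "inj_on (insert j) ?P"
    using J by (intro inj_onI) (metis DiffD1 PowD insert_ident subsetD)
  have gj: "g z {j} = \<nu> (z \<sqinter>\<^bsub>X\<^esub> x j)"
    using xj z \<nu> by (simp add: g_def X.inf_singleton Pi_def)
  have gins: "g z (insert j A) = inv g (z \<sqinter>\<^bsub>X\<^esub> x j) A" if "A \<in> ?P" for A
  proof -
    have A: "A \<subseteq> J" "finite A" "j \<notin> A" using that fin J by auto
    have "\<Sqinter>\<^bsub>X\<^esub> (x ` insert j A) = x j \<sqinter>\<^bsub>X\<^esub> \<Sqinter>\<^bsub>X\<^esub> (x ` A)"
      using A xA[of A] xj by (simp add: X.finite_inf_insert)
    then show ?thesis
      using A inf[of A] xj z \<nu>
      by (auto simp: g_def X.meet_assoc Pi_def subset_insertI2 simp flip: int_pow_neg)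
  qed
  have "incl_excl X G \<nu> x (insert j J) z = g z {j} \<otimes> (finprod G (g z) (?P \<union> insert j ` ?P))"
    unfolding incl_excl_def g_def[symmetric] split
    using J g' g[of "{j}" z] z by (intro finprod_insert) (auto simp: Pi_def)
  also have "finprod G (g z) (?P \<union> insert j ` ?P) = finprod G (g z) ?P \<otimes> finprod G (g z) (insert j ` ?P)"
    using J g' z by (intro finprod_Un_disjoint) (auto simp: Pi_def)
  also have "finprod G (g z) (insert j ` ?P) = finprod G (\<lambda>A. g z (insert j A)) ?P"
    using J g' z inj by (intro finprod_reindex) (auto simp: Pi_def)
  also have "\<dots> = finprod G (\<lambda>A. inv g (z \<sqinter>\<^bsub>X\<^esub> x j) A) ?P"
    using gins g' z xj by (intro finprod_cong) (auto simp: Pi_def simp_implies_def)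
  also have "\<dots> = inv finprod G (g (z \<sqinter>\<^bsub>X\<^esub> x j)) ?P"
    using J g' z xj by (intro finprod_inv[symmetric]) (auto simp: Pi_def)
  finally have *: "incl_excl X G \<nu> x (insert j J) z =
      \<nu> (z \<sqinter>\<^bsub>X\<^esub> x j) \<otimes> (incl_excl X G \<nu> x J z \<otimes> inv incl_excl X G \<nu> x J (z \<sqinter>\<^bsub>X\<^esub> x j))"
    by (simp only: gj incl_excl_def flip: g_def)
  have "x \<in> J \<rightarrow> carrier X" using x by auto
  then show ?thesis
    unfolding * using z xj \<nu> J incl_excl_closed[OF assms(1) \<nu> J(1)]
    by (subst m_assoc) (auto simp: Pi_def)
qed

text \<open>The definition of \<open>measures\<close> collects the index sets by size
  \<open>s\<close>. The sign depends on the size only, so it moves onto each factor, and the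
  families for \<open>1 \<le> s \<le> k\<close> make up the nonempty subsets, each once.\<close>

lemma incl_excl_by_card:
  assumes "bounded_lattice X" and \<nu>: "\<nu> \<in> carrier X \<rightarrow> carrier G" and x: "x \<in> {1..k} \<rightarrow> carrier X"
  shows "(\<Otimes>s\<in>{1..k}. (\<Otimes>A\<in>{A. A \<subseteq> {1..k} \<and> card A = s}. \<nu> (\<Sqinter>\<^bsub>X\<^esub> (x ` A)))
            [^] ((- 1) ^ (s + 1) :: int))
    = incl_excl X G \<nu> x {1..k::nat} \<top>\<^bsub>X\<^esub>"
proof -
  interpret X: bounded_lattice X by fact
  let ?F = "\<lambda>s. {A. A \<subseteq> {1..k} \<and> card A = s}"
  define g where "g A = \<nu> (\<Sqinter>\<^bsub>X\<^esub> (x ` A))" for A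
  have inf: "\<Sqinter>\<^bsub>X\<^esub> (x ` A) \<in> carrier X" if "A \<subseteq> {1..k}" for A
    using that x finite_subset[of A "{1..k}"] by (intro X.finite_inf_closed') (auto simp: Pi_def)
  then have g: "g A \<in> carrier G" if "A \<subseteq> {1..k}" for A
    using that \<nu> by (auto simp: g_def Pi_def)
  have F: "finite (?F s)" for s by (rule finite_subset[of _ "Pow {1..k}"]) auto
  have "(\<Otimes>s\<in>{1..k}. finprod G g (?F s) [^] ((- 1) ^ (s + 1) :: int))
      = (\<Otimes>s\<in>{1..k}. \<Otimes>A\<in>?F s. g A [^] ((- 1) ^ (card A + 1) :: int))"
    using g F by (intro finprod_cong)
      (auto simp: Pi_def simp_implies_def finprod_int_pow intro!: finprod_closed finprod_cong)
  also have "\<dots> = (\<Otimes>A\<in>\<Union>(?F ` {1..k}). g A [^] ((- 1) ^ (card A + 1) :: int))"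
    using g F by (intro finprod_UN_disjoint[symmetric]) (auto simp: pairwise_def disjnt_def)
  also have "\<Union>(?F ` {1..k}) = Pow {1..k} - {{}}"
  proof -
    have "1 \<le> card A" "card A \<le> k" if "A \<subseteq> {1..k}" "A \<noteq> {}" for A
      using that finite_subset[of A "{1..k}"] card_mono[of "{1..k}" A] card_gt_0_iff[of A] by auto
    then have "A \<in> \<Union>(?F ` {1..k})" if "A \<in> Pow {1..k} - {{}}" for A
      using that by (intro UN_I[of "card A"]) (simp_all del: One_nat_def)
    then show ?thesis by (auto simp del: One_nat_def UN_iff) auto
  qed
  also have "(\<Otimes>A\<in>Pow {1..k} - {{}}. g A [^] ((- 1) ^ (card A + 1) :: int)) =
      incl_excl X G \<nu> x {1..k} \<top>\<^bsub>X\<^esub>"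
    unfolding incl_excl_def using g inf
    by (intro finprod_cong) (auto simp: Pi_def simp_implies_def g_def X.meet_top)
  finally show ?thesis by (simp add: g_def)
qed

text \<open>Induction on \<open>J\<close> for all \<open>z\<close> at once: the modular law splits
  \<open>x j\<close> off the join, and its correction term is the value at the remaining join cut
  down by \<open>z \<sqinter> x j\<close>. This is the recursion of
  \<open>incl_excl_insert\<close>.\<close>

lemma modular_measure_incl_excl:
  assumes "bounded_lattice X" "modular_measure X G \<nu>" "finite J" "x \<in> J \<rightarrow> carrier X" "z \<in> carrier X"
  shows "\<nu> (z \<sqinter>\<^bsub>X\<^esub> \<Squnion>\<^bsub>X\<^esub> (x ` J)) = incl_excl X G \<nu> x J z"
  using assms(3,4,5)
proof (induction J arbitrary: z rule: finite_induct)
  case empty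
  interpret X: bounded_lattice X by fact
  show ?case using empty assms(2)
    by (simp add: X.sup_empty X.meet_bottom incl_excl_empty modular_measure_def)
next
  case (insert j J)
  interpret X: bounded_lattice X by fact
  let ?s = "\<Squnion>\<^bsub>X\<^esub> (x ` J)"
  have \<nu>: "\<nu> \<in> carrier X \<rightarrow> carrier G" using assms(2) by (simp add: modular_measure_def)
  have xj: "x j \<in> carrier X" "x ` J \<subseteq> carrier X" "x \<in> J \<rightarrow> carrier X" using insert.prems by auto
  then have s: "?s \<in> carrier X" using insert by (auto intro: X.finite_sup_closed')
  have "\<nu> (z \<sqinter>\<^bsub>X\<^esub> \<Squnion>\<^bsub>X\<^esub> (x ` insert j J)) = \<nu> (z \<sqinter>\<^bsub>X\<^esub> (x j \<squnion>\<^bsub>X\<^esub> ?s))"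
    using xj insert.hyps by (simp add: X.finite_sup_insert)
  also have "\<dots> = \<nu> (z \<sqinter>\<^bsub>X\<^esub> x j) \<otimes> \<nu> (z \<sqinter>\<^bsub>X\<^esub> ?s) \<otimes> inv \<nu> (z \<sqinter>\<^bsub>X\<^esub> (x j \<sqinter>\<^bsub>X\<^esub> ?s))"
    using assms(2) xj s insert.prems by (simp add: modular_measure_def)
  also have "z \<sqinter>\<^bsub>X\<^esub> (x j \<sqinter>\<^bsub>X\<^esub> ?s) = (z \<sqinter>\<^bsub>X\<^esub> x j) \<sqinter>\<^bsub>X\<^esub> ?s"
    using xj s insert.prems by (simp add: X.meet_assoc)
  finally show ?case
    using insert.IH xj insert.prems insert.hyps incl_excl_insert[OF assms(1) \<nu>, of J j x z]
    by (simp add: Pi_def)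
qed

text \<open>The value at \<open>z \<squnion> (a \<squnion> b)\<close> is computed twice, as a join
  of two elements and as a join of three. The two expressions differ only in the last factor, which
  in the first is the inverse of \<open>\<nu> (z \<sqinter> (a \<squnion> b))\<close>; cancelling
  the rest gives the law.\<close>

lemma measures_imp_modular_measure:
  assumes "bounded_lattice X" and \<nu>: "\<nu> \<in> measures X G"
  shows "modular_measure X G \<nu>"
proof -
  interpret X: bounded_lattice X by fact
  have \<nu>': "\<nu> \<in> carrier X \<rightarrow> carrier G" using \<nu> by (auto simp: measures_def)
  then have cl[simp]: "\<nu> a \<in> carrier G" if "a \<in> carrier X" for a using that by auto
  have law: "\<nu> (\<Squnion>\<^bsub>X\<^esub> (x ` {1..k})) = incl_excl X G \<nu> x {1..k} \<top>\<^bsub>X\<^esub>"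
    if "k \<ge> 2" "x \<in> {1..k} \<rightarrow> carrier X" for k :: nat and x
    using \<nu> that incl_excl_by_card[OF assms(1) \<nu>' that(2)] by (simp add: measures_def)
  note ins = incl_excl_insert[OF assms(1) \<nu>']
  have E1: "incl_excl X G \<nu> x {i} z = \<nu> (z \<sqinter>\<^bsub>X\<^esub> x i)"
    if "x i \<in> carrier X" "z \<in> carrier X" for x z and i :: nat
    using that ins[of "{}" i x z] by (simp add: incl_excl_empty)
  have E2: "incl_excl X G \<nu> x {2, 1::nat} z =
      \<nu> (z \<sqinter>\<^bsub>X\<^esub> x 2) \<otimes> \<nu> (z \<sqinter>\<^bsub>X\<^esub> x 1) \<otimes> inv \<nu> (z \<sqinter>\<^bsub>X\<^esub> (x 2 \<sqinter>\<^bsub>X\<^esub> x 1))"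
    if "x 1 \<in> carrier X" "x 2 \<in> carrier X" "z \<in> carrier X" for x z
    using that ins[of "{1}" 2 x z] by (simp add: E1 X.meet_assoc)
  have k2: "\<nu> (a \<squnion>\<^bsub>X\<^esub> b) = \<nu> a \<otimes> \<nu> b \<otimes> inv \<nu> (a \<sqinter>\<^bsub>X\<^esub> b)"
    if "a \<in> carrier X" "b \<in> carrier X" for a b
  proof -
    \<comment> \<open>Index 2 carries \<open>a\<close> and index 1 carries \<open>b\<close>;
      \<open>{1..2}\<close> is written with 2 in front so that \<open>E2\<close> applies.\<close>
    define x where "x i = (if i = 2 then a else b)" for i :: nat
    have 12: "{1..2} = {2, 1::nat}" by auto
    have "\<nu> (\<Squnion>\<^bsub>X\<^esub> {a, b}) = incl_excl X G \<nu> x {2, 1::nat} \<top>\<^bsub>X\<^esub>"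
      using law[of 2 x] that unfolding 12 by (simp add: x_def Pi_def insert_commute)
    also have "\<dots> = \<nu> a \<otimes> \<nu> b \<otimes> inv \<nu> (a \<sqinter>\<^bsub>X\<^esub> b)"
      using that E2[of x "\<top>\<^bsub>X\<^esub>"] by (simp add: x_def X.meet_top)
    finally show ?thesis by (simp add: join_def)
  qed
  have "\<nu> (z \<sqinter>\<^bsub>X\<^esub> (a \<squnion>\<^bsub>X\<^esub> b)) =
      \<nu> (z \<sqinter>\<^bsub>X\<^esub> a) \<otimes> \<nu> (z \<sqinter>\<^bsub>X\<^esub> b) \<otimes> inv \<nu> (z \<sqinter>\<^bsub>X\<^esub> (a \<sqinter>\<^bsub>X\<^esub> b))" (is "_ = ?w")
    if "a \<in> carrier X" "b \<in> carrier X" "z \<in> carrier X" for a b z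
  proof -
    \<comment> \<open>\<open>z\<close> gets the outermost index, so that splitting it off leaves
      inclusion-exclusion for \<open>a\<close> and \<open>b\<close>, once below
      \<open>\<top>\<close> and once below \<open>z\<close>.\<close>
    define x where "x i = (if i = 3 then z else if i = 2 then a else b)" for i :: nat
    have 123: "{1..3} = insert 3 {2, 1::nat}" by auto
    have x: "x ` {1..3} = {z, a, b}" unfolding 123 by (auto simp: x_def)
    have "\<Squnion>\<^bsub>X\<^esub> {z, a, b} = z \<squnion>\<^bsub>X\<^esub> (a \<squnion>\<^bsub>X\<^esub> b)"
      using that by (simp add: X.finite_sup_insert X.sup_empty X.join_bottom)
    then have "\<nu> (z \<squnion>\<^bsub>X\<^esub> (a \<squnion>\<^bsub>X\<^esub> b)) = incl_excl X G \<nu> x {1..3} \<top>\<^bsub>X\<^esub>"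
      using law[of 3 x] that x by (auto simp: x_def)
    also have "\<dots> = \<nu> z \<otimes> incl_excl X G \<nu> x {2, 1} \<top>\<^bsub>X\<^esub> \<otimes> inv incl_excl X G \<nu> x {2, 1} z"
      unfolding 123 using that
      by (subst ins) (auto simp: x_def X.meet_top)
    also have "incl_excl X G \<nu> x {2, 1} \<top>\<^bsub>X\<^esub> = \<nu> (a \<squnion>\<^bsub>X\<^esub> b)"
      using that E2[of x "\<top>\<^bsub>X\<^esub>"] by (simp add: x_def X.meet_top k2)
    also have "incl_excl X G \<nu> x {2, 1} z = ?w"
      using that E2[of x z] by (simp add: x_def)
    \<comment> \<open>The left side is the formula for the two elements \<open>z\<close> and
      \<open>a \<squnion> b\<close>.\<close>
    finally have "\<nu> z \<otimes> \<nu> (a \<squnion>\<^bsub>X\<^esub> b) \<otimes> inv \<nu> (z \<sqinter>\<^bsub>X\<^esub> (a \<squnion>\<^bsub>X\<^esub> b)) = \<nu> z \<otimes> \<nu> (a \<squnion>\<^bsub>X\<^esub> b) \<otimes> inv ?w"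
      using k2[of z "a \<squnion>\<^bsub>X\<^esub> b"] that by simp
    then have "inv \<nu> (z \<sqinter>\<^bsub>X\<^esub> (a \<squnion>\<^bsub>X\<^esub> b)) = inv ?w"
      using that by (subst (asm) Units_l_cancel) auto
    then show ?thesis using that by (metis cl inv_inv X.meet_closed X.join_closed inv_closed m_closed)
  qed
  then show ?thesis using \<nu> by (auto simp: modular_measure_def measures_def)
qed

text \<open>The direction from right to left is \<open>modular_measure_incl_excl\<close> at
  \<open>z = \<top>\<close>. All later arguments can thus use one law instead of a family of
  formulas indexed by \<open>k\<close>.\<close>

lemma measures_iff:
  assumes "bounded_lattice X"
  shows "\<nu> \<in> measures X G \<longleftrightarrow> \<nu> \<in> extensional (carrier X) \<and> modular_measure X G \<nu>"
proof
  assume "\<nu> \<in> measures X G"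
  then show "\<nu> \<in> extensional (carrier X) \<and> modular_measure X G \<nu>"
    using measures_imp_modular_measure[OF assms] by (auto simp: measures_def PiE_def)
next
  assume *: "\<nu> \<in> extensional (carrier X) \<and> modular_measure X G \<nu>"
  interpret X: bounded_lattice X by fact
  have \<nu>: "\<nu> \<in> carrier X \<rightarrow> carrier G" using * by (simp add: modular_measure_def)
  have "\<nu> (\<Squnion>\<^bsub>X\<^esub> (x ` {1..k})) = incl_excl X G \<nu> x {1..k} \<top>\<^bsub>X\<^esub>"
    if "x \<in> {1..k} \<rightarrow> carrier X" for k :: nat and x
  proof -
    have "\<Squnion>\<^bsub>X\<^esub> (x ` {1..k}) \<in> carrier X"
      using that by (intro X.finite_sup_closed') auto
    then show ?thesis
      using modular_measure_incl_excl[OF assms, of \<nu> "{1..k}" x "\<top>\<^bsub>X\<^esub>"] * that by (simp add: X.meet_top)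
  qed
  then show "\<nu> \<in> measures X G"
    using * \<nu> incl_excl_by_card[OF assms \<nu>]
    by (simp add: measures_def modular_measure_def PiE_def)
qed

end

subsection \<open>Additive maps out of the lattice ring\<close>

lemma keys_add_nat:
  fixes m n :: "'a \<Rightarrow>\<^sub>0 nat"
  shows "Poly_Mapping.keys (m + n) = Poly_Mapping.keys m \<union> Poly_Mapping.keys n"
  by (auto simp: in_keys_iff lookup_add)

text \<open>Multiplying by one variable at a time, repetitions included, matches taking the meet
  with one lattice element at a time.\<close>

lemma monomial_induct [case_names zero add]:
  fixes m :: "'a \<Rightarrow>\<^sub>0 nat"
  assumes "P 0" and step: "\<And>k m. P m \<Longrightarrow> P (Poly_Mapping.single k 1 + m)"
  shows "P m"
proof (induction m rule: update_induct)
  case const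
  show ?case by fact
next
  case (update f k v)
  \<comment> \<open>Each application of \<open>step\<close> raises the exponent of \<open>k\<close>
    by one, so every exponent \<open>n\<close> is reached.\<close>
  have "P (Poly_Mapping.single k n + f)" for n
  proof (induction n)
    case 0
    then show ?case using update by simp
  next
    case (Suc n)
    have "Poly_Mapping.single k (Suc n) = Poly_Mapping.single k 1 + Poly_Mapping.single k n"
      by (simp flip: single_add)
    then show ?case using step[OF Suc] by (simp add: add.assoc)
  qed
  \<comment> \<open>Here \<open>k\<close> is not a key of \<open>f\<close>, so setting its exponent
    is the same as adding the power of \<open>k\<close>.\<close>
  moreover have "Poly_Mapping.update k v f = Poly_Mapping.single k v + f"
    using update by (intro poly_mapping_eqI)
      (auto simp: lookup_update lookup_add lookup_single when_def in_keys_iff)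
  ultimately show ?case by metis
qed

text \<open>The additive extension of \<open>h\<close> to the free abelian group on its arguments;
  as \<open>B\<close> is written multiplicatively, coefficients become exponents.\<close>

definition int_combination :: "('b, 'n) monoid_scheme \<Rightarrow> ('c \<Rightarrow> 'b) \<Rightarrow> ('c \<Rightarrow>\<^sub>0 int) \<Rightarrow> 'b" where
  "int_combination B h p = (\<Otimes>\<^bsub>B\<^esub>m\<in>Poly_Mapping.keys p. h m [^]\<^bsub>B\<^esub> Poly_Mapping.lookup p m)"

context comm_group
begin

text \<open>Coefficients may cancel in a sum, so \<open>p\<close>, \<open>q\<close> and
  \<open>p + q\<close> can have different keys; over a common finite index set the products are
  compared factor by factor.\<close>

lemma int_combination_superset:
  assumes "finite K" "Poly_Mapping.keys p \<subseteq> K" "h \<in> K \<rightarrow> carrier G"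
  shows "int_combination G h p = (\<Otimes>m\<in>K. h m [^] Poly_Mapping.lookup p m)"
  unfolding int_combination_def
  using assms by (intro finprod_mono_neutral_cong_left) (auto simp: in_keys_iff Pi_def)

lemma int_combination_closed:
  assumes "h \<in> Poly_Mapping.keys p \<rightarrow> carrier G"
  shows "int_combination G h p \<in> carrier G"
  unfolding int_combination_def using assms by (intro finprod_closed) (auto simp: Pi_def)

lemma int_combination_add:
  assumes "h \<in> Poly_Mapping.keys p \<union> Poly_Mapping.keys q \<rightarrow> carrier G"
  shows "int_combination G h (p + q) = int_combination G h p \<otimes> int_combination G h q"
proof -
  let ?K = "Poly_Mapping.keys p \<union> Poly_Mapping.keys q"
  have *: "int_combination G h r = (\<Otimes>m\<in>?K. h m [^] Poly_Mapping.lookup r m)"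
    if "Poly_Mapping.keys r \<subseteq> ?K" for r
    using that assms by (intro int_combination_superset) auto
  have "(\<Otimes>m\<in>?K. h m [^] Poly_Mapping.lookup (p + q) m) =
      (\<Otimes>m\<in>?K. h m [^] Poly_Mapping.lookup p m \<otimes> h m [^] Poly_Mapping.lookup q m)"
    using assms by (intro finprod_cong)
      (auto simp: Pi_def simp_implies_def lookup_add int_pow_mult)
  also have "\<dots> = (\<Otimes>m\<in>?K. h m [^] Poly_Mapping.lookup p m) \<otimes> (\<Otimes>m\<in>?K. h m [^] Poly_Mapping.lookup q m)"
    using assms by (intro finprod_multf) (auto simp: Pi_def)
  finally show ?thesis using keys_add[of p q] by (simp add: *)
qed

lemma int_combination_diff:
  assumes "h \<in> Poly_Mapping.keys p \<union> Poly_Mapping.keys q \<rightarrow> carrier G"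
  shows "int_combination G h (p - q) = int_combination G h p \<otimes> inv int_combination G h q"
proof -
  have c: "int_combination G h (p - q) \<in> carrier G" "int_combination G h p \<in> carrier G"
      "int_combination G h q \<in> carrier G"
    using assms keys_diff[of p q] by (auto intro!: int_combination_closed)
  have "int_combination G h p = int_combination G h (p - q) \<otimes> int_combination G h q"
    using assms keys_diff[of p q] int_combination_add[of h "p - q" q] by auto
  then show ?thesis using c by (simp add: m_assoc)
qed

lemma int_combination_0: "int_combination G h 0 = \<one>"
  by (simp add: int_combination_def)

lemma int_combination_single_1: "h m \<in> carrier G \<Longrightarrow> int_combination G h (Poly_Mapping.single m 1) = h m"
  by (simp add: int_combination_def)

end

text \<open>By the meet relation and \<open>x \<sqinter> x = x\<close>, a monomial is congruent
  modulo the ideal to the variable of the meet of its support, whatever its exponents. An additive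
  extension of \<open>\<nu>\<close> that kills the ideal is therefore forced to take this
  value.\<close>

definition measure_ext :: "('a, 'm) gorder_scheme \<Rightarrow> ('b, 'n) monoid_scheme \<Rightarrow> ('a \<Rightarrow> 'b) \<Rightarrow> 'a int_mpoly \<Rightarrow> 'b"
  where "measure_ext X B \<nu> = int_combination B (\<lambda>m. \<nu> (\<Sqinter>\<^bsub>X\<^esub> (Poly_Mapping.keys m)))"

section \<open>The extension of a measure vanishes on the lattice ideal\<close>

context
  fixes X :: "('a, 'm) gorder_scheme" and B :: "('b, 'n) monoid_scheme" and \<nu>
  assumes X: "bounded_lattice X" and B: "comm_group B" and \<nu>: "modular_measure X B \<nu>"
begin

interpretation X: bounded_lattice X by (rule X)
interpretation B: comm_group B by (rule B)
interpretation P: cring "int_poly_ring (carrier X)" by (rule int_poly_ring_cring)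

private lemma carrier_iff:
  "p \<in> carrier (int_poly_ring (carrier X)) \<longleftrightarrow> Poly_Mapping.keys p \<subseteq> {m. Poly_Mapping.keys m \<subseteq> carrier X}"
  by (auto simp: int_poly_ring_def)

private lemma \<nu>_closed: "x \<in> carrier X \<Longrightarrow> \<nu> x \<in> carrier B"
  using \<nu> by (auto simp: modular_measure_def)

private lemma mon_closed:
  "Poly_Mapping.keys m \<subseteq> carrier X \<Longrightarrow> \<Sqinter>\<^bsub>X\<^esub> (Poly_Mapping.keys m) \<in> carrier X"
  by (simp add: X.finite_inf_closed')

lemma measure_ext_closed: "p \<in> carrier (int_poly_ring (carrier X)) \<Longrightarrow> measure_ext X B \<nu> p \<in> carrier B"
  unfolding measure_ext_def
  by (rule B.int_combination_closed) (auto simp: carrier_iff intro!: \<nu>_closed mon_closed)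

lemma measure_ext_add:
  assumes "p \<in> carrier (int_poly_ring (carrier X))" "q \<in> carrier (int_poly_ring (carrier X))"
  shows "measure_ext X B \<nu> (p + q) = measure_ext X B \<nu> p \<otimes>\<^bsub>B\<^esub> measure_ext X B \<nu> q"
  unfolding measure_ext_def
  using assms by (intro B.int_combination_add) (auto simp: carrier_iff intro!: \<nu>_closed mon_closed)

lemma measure_ext_diff:
  assumes "p \<in> carrier (int_poly_ring (carrier X))" "q \<in> carrier (int_poly_ring (carrier X))"
  shows "measure_ext X B \<nu> (p - q) = measure_ext X B \<nu> p \<otimes>\<^bsub>B\<^esub> inv\<^bsub>B\<^esub> measure_ext X B \<nu> q"
  unfolding measure_ext_def
  using assms by (intro B.int_combination_diff) (auto simp: carrier_iff intro!: \<nu>_closed mon_closed)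

lemma measure_ext_0: "measure_ext X B \<nu> 0 = \<one>\<^bsub>B\<^esub>"
  by (simp add: measure_ext_def B.int_combination_0)

lemma measure_ext_monomial:
  assumes "Poly_Mapping.keys m \<subseteq> carrier X"
  shows "measure_ext X B \<nu> (Poly_Mapping.single m 1) = \<nu> (\<Sqinter>\<^bsub>X\<^esub> (Poly_Mapping.keys m))"
  unfolding measure_ext_def
  by (rule B.int_combination_single_1) (auto intro!: \<nu>_closed mon_closed assms)

lemma measure_ext_var: "x \<in> carrier X \<Longrightarrow> measure_ext X B \<nu> (var x) = \<nu> x"
  using measure_ext_monomial[of "Poly_Mapping.single x 1"] by (simp add: var_def X.inf_singleton)

text \<open>By additivity in \<open>q\<close> it suffices to multiply by a monomial. With
  \<open>i\<close> the meet of its variables, a further factor \<open>var x\<close> changes the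
  value from \<open>\<nu> i\<close> to \<open>\<nu> (i \<sqinter> x)\<close>, so the join relation
  becomes the modular law at \<open>z = i\<close>. This is where the law for arbitrary
  \<open>z\<close> enters.\<close>

lemma measure_ext_generator:
  assumes "g \<in> {var \<bottom>\<^bsub>X\<^esub>, var \<top>\<^bsub>X\<^esub> - 1}
       \<union> {var (x \<sqinter>\<^bsub>X\<^esub> y) - var x * var y | x y. x \<in> carrier X \<and> y \<in> carrier X}
       \<union> {var (x \<squnion>\<^bsub>X\<^esub> y) - var x - var y + var x * var y | x y. x \<in> carrier X \<and> y \<in> carrier X}"
    and "q \<in> carrier (int_poly_ring (carrier X))"
  shows "measure_ext X B \<nu> (g * q) = \<one>\<^bsub>B\<^esub>"
proof -
  let ?R = "int_poly_ring (carrier X)" and ?M = "{m. Poly_Mapping.keys m \<subseteq> carrier X}"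
  have g: "g \<in> carrier ?R" using assms(1) lattice_ideal_generators[OF X] by blast
  have mono: "measure_ext X B \<nu> (g * frag_of m) = \<one>\<^bsub>B\<^esub>" if m: "m \<in> ?M" for m
  proof -
    let ?i = "\<Sqinter>\<^bsub>X\<^esub> (Poly_Mapping.keys m)"
    have i: "?i \<in> carrier X" using m mon_closed by blast
    have fm: "frag_of m \<in> carrier ?R" using m by (simp add: carrier_iff)
    have vc: "var x * frag_of m \<in> carrier ?R" if "x \<in> carrier X" for x
      using that fm by (intro int_poly_ring_carrier_mult var_carrier)
    have v2c: "var x * var y * frag_of m \<in> carrier ?R" if "x \<in> carrier X" "y \<in> carrier X" for x y
      using that fm by (intro int_poly_ring_carrier_mult var_carrier)
    have E0: "measure_ext X B \<nu> (frag_of m) = \<nu> ?i"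
      using m measure_ext_monomial[of m] by simp
    have E1: "measure_ext X B \<nu> (var x * frag_of m) = \<nu> (?i \<sqinter>\<^bsub>X\<^esub> x)" if "x \<in> carrier X" for x
      using m that measure_ext_monomial[of "Poly_Mapping.single x 1 + m"]
      by (simp add: var_def mult_single keys_add_nat X.finite_inf_insert meet_comm)
    \<comment> \<open>Only supports matter, so \<open>x = y\<close> and variables already present in
      \<open>m\<close> are covered as well.\<close>
    have E2: "measure_ext X B \<nu> (var x * var y * frag_of m) = \<nu> (?i \<sqinter>\<^bsub>X\<^esub> (x \<sqinter>\<^bsub>X\<^esub> y))"
      if "x \<in> carrier X" "y \<in> carrier X" for x y
    proof -
      have "\<nu> (\<Sqinter>\<^bsub>X\<^esub> ({x, y} \<union> Poly_Mapping.keys m)) = \<nu> (?i \<sqinter>\<^bsub>X\<^esub> (x \<sqinter>\<^bsub>X\<^esub> y))"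
        using m that i X.finite_inf_Un[of "{x, y}" "Poly_Mapping.keys m"]
        by (simp add: meet_comm[of X ?i]) (simp add: meet_def)
      moreover have "{x, y} \<union> Poly_Mapping.keys m
          = Poly_Mapping.keys (Poly_Mapping.single x 1 + Poly_Mapping.single y 1 + m)"
        by (auto simp: keys_add_nat)
      ultimately show ?thesis
        using m that measure_ext_monomial[of "Poly_Mapping.single x 1 + Poly_Mapping.single y 1 + m"]
        by (simp add: var_def mult_single keys_add_nat)
    qed
    consider "g = var \<bottom>\<^bsub>X\<^esub>" | "g = var \<top>\<^bsub>X\<^esub> - 1"
      | x y where "x \<in> carrier X" "y \<in> carrier X" "g = var (x \<sqinter>\<^bsub>X\<^esub> y) - var x * var y"
      | x y where "x \<in> carrier X" "y \<in> carrier X" "g = var (x \<squnion>\<^bsub>X\<^esub> y) - var x - var y + var x * var y"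
      using assms(1) by blast
    then show ?thesis
    proof cases
      case 1
      then show ?thesis using i \<nu> by (simp add: E1 X.meet_bottom modular_measure_def)
    next
      case 2
      then have "measure_ext X B \<nu> (g * frag_of m) = \<nu> (?i \<sqinter>\<^bsub>X\<^esub> \<top>\<^bsub>X\<^esub>) \<otimes>\<^bsub>B\<^esub> inv\<^bsub>B\<^esub> \<nu> ?i"
        using vc fm by (simp only: left_diff_distrib mult_1 measure_ext_diff E1 E0 X.top_closed)
      then show ?thesis using i \<nu>_closed by (simp add: meet_comm[of X ?i] X.meet_top)
    next
      case (3 x y)
      then have "measure_ext X B \<nu> (g * frag_of m) =
          \<nu> (?i \<sqinter>\<^bsub>X\<^esub> (x \<sqinter>\<^bsub>X\<^esub> y)) \<otimes>\<^bsub>B\<^esub> inv\<^bsub>B\<^esub> \<nu> (?i \<sqinter>\<^bsub>X\<^esub> (x \<sqinter>\<^bsub>X\<^esub> y))"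
        using vc v2c by (simp only: left_diff_distrib measure_ext_diff E1 E2 X.meet_closed)
      then show ?thesis using 3 i \<nu>_closed by simp
    next
      case (4 x y)
      let ?a = "\<nu> (?i \<sqinter>\<^bsub>X\<^esub> x)" and ?b = "\<nu> (?i \<sqinter>\<^bsub>X\<^esub> y)" and ?c = "\<nu> (?i \<sqinter>\<^bsub>X\<^esub> (x \<sqinter>\<^bsub>X\<^esub> y))"
      have c: "?a \<in> carrier B" "?b \<in> carrier B" "?c \<in> carrier B"
        using 4 i by (auto intro!: \<nu>_closed)
      have "measure_ext X B \<nu> (g * frag_of m) =
          \<nu> (?i \<sqinter>\<^bsub>X\<^esub> (x \<squnion>\<^bsub>X\<^esub> y)) \<otimes>\<^bsub>B\<^esub> inv\<^bsub>B\<^esub> ?a \<otimes>\<^bsub>B\<^esub> inv\<^bsub>B\<^esub> ?b \<otimes>\<^bsub>B\<^esub> ?c"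
        using 4 vc v2c
        by (simp only: left_diff_distrib distrib_right measure_ext_diff measure_ext_add
            E1 E2 X.join_closed int_poly_ring_carrier_diff)
      also have "\<nu> (?i \<sqinter>\<^bsub>X\<^esub> (x \<squnion>\<^bsub>X\<^esub> y)) = ?a \<otimes>\<^bsub>B\<^esub> ?b \<otimes>\<^bsub>B\<^esub> inv\<^bsub>B\<^esub> ?c"
        using \<nu> 4 i by (simp add: modular_measure_def)
      also have "?a \<otimes>\<^bsub>B\<^esub> ?b \<otimes>\<^bsub>B\<^esub> inv\<^bsub>B\<^esub> ?c \<otimes>\<^bsub>B\<^esub> inv\<^bsub>B\<^esub> ?a \<otimes>\<^bsub>B\<^esub> inv\<^bsub>B\<^esub> ?b \<otimes>\<^bsub>B\<^esub> ?c
          = (?a \<otimes>\<^bsub>B\<^esub> inv\<^bsub>B\<^esub> ?a) \<otimes>\<^bsub>B\<^esub> ((?b \<otimes>\<^bsub>B\<^esub> inv\<^bsub>B\<^esub> ?b) \<otimes>\<^bsub>B\<^esub> (?c \<otimes>\<^bsub>B\<^esub> inv\<^bsub>B\<^esub> ?c))"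
        using c by (simp only: B.m_ac B.inv_closed B.m_closed)
      also have "\<dots> = \<one>\<^bsub>B\<^esub>" using c by simp
      finally show ?thesis .
    qed
  qed
  have "Poly_Mapping.keys q \<subseteq> ?M" using assms(2) carrier_iff by blast
  \<comment> \<open>Membership in the ring is carried along because the difference case of the
    induction supplies nothing but the induction hypotheses.\<close>
  then have "q \<in> carrier ?R \<and> measure_ext X B \<nu> (g * q) = \<one>\<^bsub>B\<^esub>"
  proof (induction q rule: frag_induction)
    case zero
    then show ?case by (simp add: measure_ext_0 carrier_iff)
  next
    case (one m)
    then show ?case using mono[OF one] by (simp add: carrier_iff)
  next
    case (diff a b)
    then show ?case
      using g by (simp add: right_diff_distrib measure_ext_diff int_poly_ring_carrier_mult
          int_poly_ring_carrier_diff)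
  qed
  then show ?thesis by simp
qed

text \<open>An additive map that kills the generators may still fail to kill the ideal; what
  suffices is that all multiples of the generators are killed.\<close>

lemma measure_ext_lattice_ideal:
  assumes "p \<in> lattice_ideal X"
  shows "measure_ext X B \<nu> p = \<one>\<^bsub>B\<^esub>"
proof -
  let ?R = "int_poly_ring (carrier X)"
  \<comment> \<open>\<open>?J\<close> is the largest ideal inside the kernel of
    \<open>measure_ext X B \<nu>\<close>, a kernel known only to be an additive subgroup.\<close>
  let ?J = "{p \<in> carrier ?R. \<forall>q\<in>carrier ?R. measure_ext X B \<nu> (p * q) = \<one>\<^bsub>B\<^esub>}"
  have R: "\<one>\<^bsub>?R\<^esub> = 1" "\<zero>\<^bsub>?R\<^esub> = 0" "\<And>a b. a \<otimes>\<^bsub>?R\<^esub> b = a * b" "\<And>a b. a \<oplus>\<^bsub>?R\<^esub> b = a + b"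
    by (simp_all add: int_poly_ring_def)
  have "ideal ?J ?R"
  proof (rule idealI)
    show "ring ?R" by (rule P.ring_axioms)
    show "subgroup ?J (add_monoid ?R)"
    proof (rule P.add.subgroupI)
      show "?J \<noteq> {}" using P.zero_closed by (auto simp: R measure_ext_0 intro!: exI[of _ 0])
    next
      fix a assume a: "a \<in> ?J"
      have "measure_ext X B \<nu> ((0 - a) * q) = \<one>\<^bsub>B\<^esub>" if "q \<in> carrier ?R" for q
        using a that P.zero_closed measure_ext_diff[of 0 "a * q"]
        by (simp add: R measure_ext_0 int_poly_ring_carrier_mult)
      moreover have "\<ominus>\<^bsub>?R\<^esub> a = 0 - a"
        using int_poly_ring_minus[of 0 "carrier X" a] a P.zero_closed P.a_inv_closed[of a]
        by (auto simp: R a_minus_def)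
      ultimately show "\<ominus>\<^bsub>?R\<^esub> a \<in> ?J" using a P.a_inv_closed[of a] by auto
    next
      fix a b assume "a \<in> ?J" "b \<in> ?J"
      then show "a \<oplus>\<^bsub>?R\<^esub> b \<in> ?J"
        using P.a_closed[of a b]
        by (auto simp: R distrib_right measure_ext_add int_poly_ring_carrier_mult)
    qed auto
  next
    fix a x assume a: "a \<in> ?J" and x: "x \<in> carrier ?R"
    then show "a \<otimes>\<^bsub>?R\<^esub> x \<in> ?J"
      by (auto simp: R int_poly_ring_carrier_mult mult.assoc)
    then show "x \<otimes>\<^bsub>?R\<^esub> a \<in> ?J"
      using a x P.m_comm by simp
  qed
  then have "lattice_ideal X \<subseteq> ?J"
    unfolding lattice_ideal_def
  proof (rule P.genideal_minimal)
    show "{var \<bottom>\<^bsub>X\<^esub>, var \<top>\<^bsub>X\<^esub> - 1}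
       \<union> {var (x \<sqinter>\<^bsub>X\<^esub> y) - var x * var y | x y. x \<in> carrier X \<and> y \<in> carrier X}
       \<union> {var (x \<squnion>\<^bsub>X\<^esub> y) - var x - var y + var x * var y | x y. x \<in> carrier X \<and> y \<in> carrier X}
       \<subseteq> ?J" (is "?S \<subseteq> _")
    proof
      fix g assume g: "g \<in> ?S"
      then show "g \<in> ?J"
        using subsetD[OF lattice_ideal_generators[OF X] g] measure_ext_generator[OF g] by simp
    qed
  qed
  \<comment> \<open>The factor 1 recovers the value at \<open>p\<close> itself.\<close>
  then have "measure_ext X B \<nu> (p * 1) = \<one>\<^bsub>B\<^esub>"
    using assms P.one_closed unfolding R by blast
  then show ?thesis by simp
qed

end

subsection \<open>The lattice ring\<close>

lemma zero_lattice_ring: "\<zero>\<^bsub>lattice_ring X\<^esub> = lattice_ideal X"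
  by (simp add: lattice_ring_def FactRing_def)

context
  fixes X :: "('a, 'm) gorder_scheme"
  assumes X: "bounded_lattice X"
begin

interpretation X: bounded_lattice X by (rule X)
interpretation P: cring "int_poly_ring (carrier X)" by (rule int_poly_ring_cring)
interpretation I: ideal "lattice_ideal X" "int_poly_ring (carrier X)" by (rule lattice_ideal_ideal[OF X])
interpretation R: cring "lattice_ring X" by (rule lattice_ring_cring[OF X])
interpretation q: ring_hom_cring "int_poly_ring (carrier X)" "lattice_ring X"
    "(+>\<^bsub>int_poly_ring (carrier X)\<^esub>) (lattice_ideal X)"
  unfolding lattice_ring_def by (rule I.rcos_ring_hom_cring[OF int_poly_ring_cring])

private lemma poly_ops:
  "\<one>\<^bsub>int_poly_ring (carrier X)\<^esub> = 1" "\<zero>\<^bsub>int_poly_ring (carrier X)\<^esub> = 0"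
  "a \<otimes>\<^bsub>int_poly_ring (carrier X)\<^esub> b = a * b" "a \<oplus>\<^bsub>int_poly_ring (carrier X)\<^esub> b = a + b"
  by (simp_all add: int_poly_ring_def)

private lemma coset_diff:
  assumes "p \<in> carrier (int_poly_ring (carrier X))" "r \<in> carrier (int_poly_ring (carrier X))"
  shows "lattice_ideal X +>\<^bsub>int_poly_ring (carrier X)\<^esub> (p - r) =
    (lattice_ideal X +>\<^bsub>int_poly_ring (carrier X)\<^esub> p) \<ominus>\<^bsub>lattice_ring X\<^esub>
    (lattice_ideal X +>\<^bsub>int_poly_ring (carrier X)\<^esub> r)"
  using assms q.hom_add[OF assms(1) P.a_inv_closed[OF assms(2)]]
  by (simp add: a_minus_def int_poly_ring_minus[OF assms, symmetric])

private lemma coset_zero: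
  assumes "p \<in> lattice_ideal X"
  shows "lattice_ideal X +>\<^bsub>int_poly_ring (carrier X)\<^esub> p = \<zero>\<^bsub>lattice_ring X\<^esub>"
  unfolding I.a_rcos_const[OF assms] zero_lattice_ring ..

private lemma coset_rep:
  assumes "a \<in> carrier (lattice_ring X)"
  shows "\<exists>p\<in>carrier (int_poly_ring (carrier X)). a = lattice_ideal X +>\<^bsub>int_poly_ring (carrier X)\<^esub> p"
  using assms unfolding lattice_ring_def FactRing_simps by auto

private lemma generator_mem:
  assumes "g \<in> {var \<bottom>\<^bsub>X\<^esub>, var \<top>\<^bsub>X\<^esub> - 1}
       \<union> {var (x \<sqinter>\<^bsub>X\<^esub> y) - var x * var y | x y. x \<in> carrier X \<and> y \<in> carrier X}
       \<union> {var (x \<squnion>\<^bsub>X\<^esub> y) - var x - var y + var x * var y | x y. x \<in> carrier X \<and> y \<in> carrier X}"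
  shows "g \<in> lattice_ideal X"
  unfolding lattice_ideal_def
  by (rule subsetD[OF P.genideal_self[OF lattice_ideal_generators[OF X]] assms])

lemma lattice_class_closed: "x \<in> carrier X \<Longrightarrow> lattice_class X x \<in> carrier (lattice_ring X)"
  using lattice_class_idempotent[OF X] by (auto simp: idempotents_def)

lemma lattice_class_bottom: "lattice_class X \<bottom>\<^bsub>X\<^esub> = \<zero>\<^bsub>lattice_ring X\<^esub>"
  unfolding lattice_class_def by (intro coset_zero generator_mem) simp

lemma lattice_class_top: "lattice_class X \<top>\<^bsub>X\<^esub> = \<one>\<^bsub>lattice_ring X\<^esub>"
proof -
  have "var \<top>\<^bsub>X\<^esub> - 1 \<in> lattice_ideal X" by (rule generator_mem) blast
  then have "lattice_class X \<top>\<^bsub>X\<^esub> \<ominus>\<^bsub>lattice_ring X\<^esub> \<one>\<^bsub>lattice_ring X\<^esub> = \<zero>\<^bsub>lattice_ring X\<^esub>"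
    using coset_zero coset_diff[of "var \<top>\<^bsub>X\<^esub>" 1] q.hom_one P.one_closed var_carrier[of "\<top>\<^bsub>X\<^esub>" "carrier X"]
    by (simp add: lattice_class_def poly_ops)
  then show ?thesis using R.r_right_minus_eq lattice_class_closed by simp
qed

lemma lattice_class_meet:
  assumes "x \<in> carrier X" "y \<in> carrier X"
  shows "lattice_class X (x \<sqinter>\<^bsub>X\<^esub> y) = lattice_class X x \<otimes>\<^bsub>lattice_ring X\<^esub> lattice_class X y"
proof -
  have v: "var z \<in> carrier (int_poly_ring (carrier X))" if "z \<in> carrier X" for z
    using that by (rule var_carrier)
  have "var (x \<sqinter>\<^bsub>X\<^esub> y) - var x * var y \<in> lattice_ideal X"
    using assms by (intro generator_mem) blast
  then have "lattice_class X (x \<sqinter>\<^bsub>X\<^esub> y) \<ominus>\<^bsub>lattice_ring X\<^esub>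
      lattice_class X x \<otimes>\<^bsub>lattice_ring X\<^esub> lattice_class X y = \<zero>\<^bsub>lattice_ring X\<^esub>"
    using assms v coset_zero coset_diff[of "var (x \<sqinter>\<^bsub>X\<^esub> y)" "var x * var y"] q.hom_mult[of "var x" "var y"]
    by (simp add: lattice_class_def poly_ops int_poly_ring_carrier_mult)
  then show ?thesis using assms R.r_right_minus_eq lattice_class_closed by simp
qed

lemma lattice_class_join:
  assumes "x \<in> carrier X" "y \<in> carrier X"
  shows "lattice_class X (x \<squnion>\<^bsub>X\<^esub> y) = lattice_class X x \<oplus>\<^bsub>lattice_ring X\<^esub> lattice_class X y
    \<ominus>\<^bsub>lattice_ring X\<^esub> lattice_class X x \<otimes>\<^bsub>lattice_ring X\<^esub> lattice_class X y"
proof -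
  have v: "var z \<in> carrier (int_poly_ring (carrier X))" if "z \<in> carrier X" for z
    using that by (rule var_carrier)
  have vs: "var x + var y - var x * var y \<in> carrier (int_poly_ring (carrier X))"
      "var x + var y \<in> carrier (int_poly_ring (carrier X))"
    using assms v P.a_closed[of "var x" "var y"]
    by (auto simp: poly_ops int_poly_ring_carrier_mult int_poly_ring_carrier_diff)
  have "var (x \<squnion>\<^bsub>X\<^esub> y) - var x - var y + var x * var y \<in> lattice_ideal X"
    using assms by (intro generator_mem) blast
  \<comment> \<open>Regrouped as one difference, so that membership in the ideal reads as equality
    of two cosets.\<close>
  then have "var (x \<squnion>\<^bsub>X\<^esub> y) - (var x + var y - var x * var y) \<in> lattice_ideal X"
    by (simp add: algebra_simps)
  then have "lattice_class X (x \<squnion>\<^bsub>X\<^esub> y) \<ominus>\<^bsub>lattice_ring X\<^esub> (lattice_class X x \<oplus>\<^bsub>lattice_ring X\<^esub> lattice_class X y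
    \<ominus>\<^bsub>lattice_ring X\<^esub> lattice_class X x \<otimes>\<^bsub>lattice_ring X\<^esub> lattice_class X y) = \<zero>\<^bsub>lattice_ring X\<^esub>"
    using assms v vs coset_zero coset_diff[of "var (x \<squnion>\<^bsub>X\<^esub> y)" "var x + var y - var x * var y"]
      coset_diff[of "var x + var y" "var x * var y"]
      q.hom_mult[of "var x" "var y"] q.hom_add[of "var x" "var y"]
    by (simp add: lattice_class_def poly_ops int_poly_ring_carrier_mult)
  then show ?thesis using assms R.r_right_minus_eq lattice_class_closed by simp
qed

text \<open>One variable at a time by \<open>lattice_class_meet\<close>, starting from the monomial
  1, whose class is that of \<open>\<top>\<close>. As a consequence the classes of lattice elements
  span the ring additively.\<close>

lemma coset_monomial:
  assumes "Poly_Mapping.keys m \<subseteq> carrier X"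
  shows "lattice_ideal X +>\<^bsub>int_poly_ring (carrier X)\<^esub> (Poly_Mapping.single m 1)
    = lattice_class X (\<Sqinter>\<^bsub>X\<^esub> (Poly_Mapping.keys m))"
  using assms
proof (induction m rule: monomial_induct)
  case zero
  show ?case using q.hom_one lattice_class_top by (simp add: X.inf_empty poly_ops)
next
  case (add k m)
  have k: "k \<in> carrier X" and m: "Poly_Mapping.keys m \<subseteq> carrier X"
    using add.prems by (auto simp: keys_add_nat)
  have c: "var k \<in> carrier (int_poly_ring (carrier X))"
      "Poly_Mapping.single m 1 \<in> carrier (int_poly_ring (carrier X))"
    using k m var_carrier[OF k] by (auto simp: int_poly_ring_def)
  have "Poly_Mapping.single (Poly_Mapping.single k 1 + m) 1 = var k * Poly_Mapping.single m 1"
    by (simp add: var_def mult_single)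
  then have "lattice_ideal X +>\<^bsub>int_poly_ring (carrier X)\<^esub> (Poly_Mapping.single (Poly_Mapping.single k 1 + m) 1)
    = lattice_class X k \<otimes>\<^bsub>lattice_ring X\<^esub> lattice_class X (\<Sqinter>\<^bsub>X\<^esub> (Poly_Mapping.keys m))"
    using q.hom_mult[OF c] add.IH[OF m] by (simp add: poly_ops lattice_class_def)
  also have "\<dots> = lattice_class X (k \<sqinter>\<^bsub>X\<^esub> \<Sqinter>\<^bsub>X\<^esub> (Poly_Mapping.keys m))"
    using k m by (simp add: lattice_class_meet X.finite_inf_closed')
  also have "k \<sqinter>\<^bsub>X\<^esub> \<Sqinter>\<^bsub>X\<^esub> (Poly_Mapping.keys m) = \<Sqinter>\<^bsub>X\<^esub> (Poly_Mapping.keys (Poly_Mapping.single k 1 + m))"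
    using k m by (simp add: keys_add_nat X.finite_inf_insert)
  finally show ?case .
qed

text \<open>Polynomials arise from monomials by differences, and \<open>coset_monomial\<close> turns
  monomials into classes of lattice elements. Zero has no case of its own, being the class of
  \<open>\<bottom>\<close>.\<close>

lemma lattice_ring_induct [consumes 2, case_names lattice_class diff]:
  assumes "a \<in> carrier (lattice_ring X)"
    and base: "\<And>x. x \<in> carrier X \<Longrightarrow> Q (lattice_class X x)"
    and diff: "\<And>a b. a \<in> carrier (lattice_ring X) \<Longrightarrow> b \<in> carrier (lattice_ring X) \<Longrightarrow> Q a \<Longrightarrow> Q b
      \<Longrightarrow> Q (a \<ominus>\<^bsub>lattice_ring X\<^esub> b)"
  shows "Q a"
proof -
  let ?R = "int_poly_ring (carrier X)"
  obtain p where p: "p \<in> carrier ?R" "a = lattice_ideal X +>\<^bsub>?R\<^esub> p"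
    using coset_rep[OF assms(1)] by blast
  have "Poly_Mapping.keys p \<subseteq> {m. Poly_Mapping.keys m \<subseteq> carrier X}"
    using p by (auto simp: int_poly_ring_def)
  then have "p \<in> carrier ?R \<and> Q (lattice_ideal X +>\<^bsub>?R\<^esub> p)"
  proof (induction p rule: frag_induction)
    case zero
    have "Q \<zero>\<^bsub>lattice_ring X\<^esub>" using base[OF X.bottom_closed] lattice_class_bottom by simp
    then show ?case using q.hom_zero P.zero_closed by (simp add: poly_ops)
  next
    case (one m)
    then show ?case
      using base X.finite_inf_closed' coset_monomial[of m] by (auto simp: int_poly_ring_def)
  next
    case (diff a b)
    then show ?case using assms(3) coset_diff q.hom_closed
      by (auto simp: int_poly_ring_carrier_diff)
  qed
  then show ?thesis using p by simp
qed

text \<open>The additive extension of \<open>\<nu>\<close> to polynomials kills the ideal, hence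
  takes a single value on each coset.\<close>

lemma modular_measure_extends:
  assumes B: "comm_group B" and \<nu>: "modular_measure X B \<nu>"
  obtains \<phi> where "\<phi> \<in> hom (add_monoid (lattice_ring X)) B" "\<And>x. x \<in> carrier X \<Longrightarrow> \<phi> (lattice_class X x) = \<nu> x"
proof -
  let ?R = "int_poly_ring (carrier X)"
  interpret B: comm_group B by (rule B)
  \<comment> \<open>The value is read off an arbitrary representative; the next step shows that the
    choice is immaterial.\<close>
  define \<phi> where "\<phi> C = measure_ext X B \<nu> (SOME p. p \<in> C)" for C
  have \<phi>: "\<phi> (lattice_ideal X +>\<^bsub>?R\<^esub> p) = measure_ext X B \<nu> p" if p: "p \<in> carrier ?R" for p
  proof -
    define r where "r = (SOME r. r \<in> lattice_ideal X +>\<^bsub>?R\<^esub> p)"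
    have "r \<in> lattice_ideal X +>\<^bsub>?R\<^esub> p"
      unfolding r_def by (rule someI[of _ p]) (use p in \<open>rule I.a_rcos_self\<close>)
    then obtain i where i: "i \<in> lattice_ideal X" "r = i + p"
      by (auto simp: a_r_coset_def' poly_ops)
    then have "i \<in> carrier ?R" using I.a_subset by blast
    then have "measure_ext X B \<nu> r = measure_ext X B \<nu> i \<otimes>\<^bsub>B\<^esub> measure_ext X B \<nu> p"
      unfolding i(2) using p by (rule measure_ext_add[OF X B \<nu>])
    then show ?thesis
      using measure_ext_lattice_ideal[OF X B \<nu> i(1)] measure_ext_closed[OF X B \<nu> p]
      by (simp add: \<phi>_def flip: r_def)
  qed
  show ?thesis
  proof
    show "\<phi> \<in> hom (add_monoid (lattice_ring X)) B"
    proof (rule homI)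
      fix a assume "a \<in> carrier (add_monoid (lattice_ring X))"
      then show "\<phi> a \<in> carrier B" using coset_rep[of a] \<phi> measure_ext_closed[OF X B \<nu>] by auto
    next
      fix a b assume "a \<in> carrier (add_monoid (lattice_ring X))" "b \<in> carrier (add_monoid (lattice_ring X))"
      then obtain p r where p: "p \<in> carrier ?R" "a = lattice_ideal X +>\<^bsub>?R\<^esub> p"
        and r: "r \<in> carrier ?R" "b = lattice_ideal X +>\<^bsub>?R\<^esub> r"
        using coset_rep[of a] coset_rep[of b] by auto
      have "a \<oplus>\<^bsub>lattice_ring X\<^esub> b = lattice_ideal X +>\<^bsub>?R\<^esub> (p + r)"
        using q.hom_add[OF p(1) r(1)] p r by (simp add: poly_ops)
      then show "\<phi> (a \<otimes>\<^bsub>add_monoid (lattice_ring X)\<^esub> b) = \<phi> a \<otimes>\<^bsub>B\<^esub> \<phi> b"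
        using p r \<phi> P.a_closed[OF p(1) r(1)] measure_ext_add[OF X B \<nu> p(1) r(1)] by (simp add: poly_ops)
    qed
    show "\<phi> (lattice_class X x) = \<nu> x" if "x \<in> carrier X" for x
      using that \<phi>[OF var_carrier[OF that]] measure_ext_var[OF X B \<nu> that] by (simp add: lattice_class_def)
  qed
qed

end

text \<open>A bounded-lattice homomorphism into the idempotents of \<open>R\<close>; the values are
  idempotent because \<open>x \<sqinter> x = x\<close>. Ring homomorphisms out of the lattice ring
  induce exactly this kind of map on \<open>X\<close>.\<close>

definition lattice_rep :: "('a, 'm) gorder_scheme \<Rightarrow> ('r, 'n) ring_scheme \<Rightarrow> ('a \<Rightarrow> 'r) \<Rightarrow> bool" where
  "lattice_rep X R f \<longleftrightarrow>
    f \<in> carrier X \<rightarrow> carrier R \<and> f \<bottom>\<^bsub>X\<^esub> = \<zero>\<^bsub>R\<^esub> \<and> f \<top>\<^bsub>X\<^esub> = \<one>\<^bsub>R\<^esub> \<and>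
    (\<forall>x\<in>carrier X. \<forall>y\<in>carrier X. f (x \<sqinter>\<^bsub>X\<^esub> y) = f x \<otimes>\<^bsub>R\<^esub> f y) \<and>
    (\<forall>x\<in>carrier X. \<forall>y\<in>carrier X. f (x \<squnion>\<^bsub>X\<^esub> y) = f x \<oplus>\<^bsub>R\<^esub> f y \<ominus>\<^bsub>R\<^esub> f x \<otimes>\<^bsub>R\<^esub> f y)"

lemma additive_hom_diff:
  assumes "abelian_group R" "group B" "\<phi> \<in> hom (add_monoid R) B" "a \<in> carrier R" "b \<in> carrier R"
  shows "\<phi> (a \<ominus>\<^bsub>R\<^esub> b) = \<phi> a \<otimes>\<^bsub>B\<^esub> inv\<^bsub>B\<^esub> \<phi> b"
proof -
  interpret R: abelian_group R by fact
  interpret \<phi>: group_hom "add_monoid R" B \<phi>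
    using assms(2,3) R.a_group by (simp add: group_hom_def group_hom_axioms_def)
  have "\<phi> (a \<ominus>\<^bsub>R\<^esub> b) = \<phi> a \<otimes>\<^bsub>B\<^esub> \<phi> (\<ominus>\<^bsub>R\<^esub> b)"
    using assms(4,5) \<phi>.hom_mult[of a "\<ominus>\<^bsub>R\<^esub> b"] by (simp add: a_minus_def)
  also have "\<phi> (\<ominus>\<^bsub>R\<^esub> b) = inv\<^bsub>B\<^esub> \<phi> b"
    using assms(5) \<phi>.hom_inv[of b] by (simp add: a_inv_def)
  finally show ?thesis .
qed

text \<open>A ring is distributive even when \<open>X\<close> is not: expanding \<open>f z\<close>
  times \<open>f x + f y - f x * f y\<close> gives the modular law for every \<open>z\<close>, and
  the additive map \<open>\<phi>\<close> carries it to \<open>B\<close>.\<close>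

lemma lattice_rep_modular_measure:
  assumes X: "bounded_lattice X" and R: "cring R" and f: "lattice_rep X R f"
    and B: "comm_group B" and \<phi>: "\<phi> \<in> hom (add_monoid R) B"
  shows "modular_measure X B (\<lambda>x. \<phi> (f x))"
proof -
  interpret X: bounded_lattice X by (rule X)
  interpret R: cring R by (rule R)
  interpret B: comm_group B by (rule B)
  interpret \<phi>: group_hom "add_monoid R" B \<phi>
    using \<phi> R.a_group by (simp add: group_hom_def group_hom_axioms_def B.group_axioms)
  have fc: "f x \<in> carrier R" if "x \<in> carrier X" for x using f that by (auto simp: lattice_rep_def)
  have "\<phi> (f (z \<sqinter>\<^bsub>X\<^esub> (x \<squnion>\<^bsub>X\<^esub> y))) =
      \<phi> (f (z \<sqinter>\<^bsub>X\<^esub> x)) \<otimes>\<^bsub>B\<^esub> \<phi> (f (z \<sqinter>\<^bsub>X\<^esub> y)) \<otimes>\<^bsub>B\<^esub> inv\<^bsub>B\<^esub> \<phi> (f (z \<sqinter>\<^bsub>X\<^esub> (x \<sqinter>\<^bsub>X\<^esub> y)))"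
    if xyz: "x \<in> carrier X" "y \<in> carrier X" "z \<in> carrier X" for x y z
  proof -
    note c = fc[OF xyz(1)] fc[OF xyz(2)] fc[OF xyz(3)]
    have "f (z \<sqinter>\<^bsub>X\<^esub> (x \<squnion>\<^bsub>X\<^esub> y)) = f z \<otimes>\<^bsub>R\<^esub> (f x \<oplus>\<^bsub>R\<^esub> f y \<ominus>\<^bsub>R\<^esub> f x \<otimes>\<^bsub>R\<^esub> f y)"
      using f xyz by (simp add: lattice_rep_def)
    also have "\<dots> = f z \<otimes>\<^bsub>R\<^esub> f x \<oplus>\<^bsub>R\<^esub> f z \<otimes>\<^bsub>R\<^esub> f y \<ominus>\<^bsub>R\<^esub> f z \<otimes>\<^bsub>R\<^esub> (f x \<otimes>\<^bsub>R\<^esub> f y)"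
      using c by algebra
    finally have "\<phi> (f (z \<sqinter>\<^bsub>X\<^esub> (x \<squnion>\<^bsub>X\<^esub> y))) =
        \<phi> (f z \<otimes>\<^bsub>R\<^esub> f x \<oplus>\<^bsub>R\<^esub> f z \<otimes>\<^bsub>R\<^esub> f y) \<otimes>\<^bsub>B\<^esub> inv\<^bsub>B\<^esub> \<phi> (f z \<otimes>\<^bsub>R\<^esub> (f x \<otimes>\<^bsub>R\<^esub> f y))"
      using additive_hom_diff[OF R.abelian_group_axioms B.group_axioms \<phi>] c by simp
    also have "\<phi> (f z \<otimes>\<^bsub>R\<^esub> f x \<oplus>\<^bsub>R\<^esub> f z \<otimes>\<^bsub>R\<^esub> f y) = \<phi> (f z \<otimes>\<^bsub>R\<^esub> f x) \<otimes>\<^bsub>B\<^esub> \<phi> (f z \<otimes>\<^bsub>R\<^esub> f y)"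
      using c \<phi>.hom_mult[of "f z \<otimes>\<^bsub>R\<^esub> f x" "f z \<otimes>\<^bsub>R\<^esub> f y"] by simp
    finally show ?thesis using f xyz by (simp add: lattice_rep_def)
  qed
  moreover have "\<phi> (f \<bottom>\<^bsub>X\<^esub>) = \<one>\<^bsub>B\<^esub>" using f \<phi>.hom_one by (simp add: lattice_rep_def)
  moreover have "\<phi> (f x) \<in> carrier B" if "x \<in> carrier X" for x
    using fc[OF that] \<phi>.hom_closed[of "f x"] by simp
  ultimately show ?thesis by (simp add: modular_measure_def Pi_def)
qed

text \<open>Uniqueness to accompany \<open>modular_measure_extends\<close>, because classes of
  lattice elements generate the ring additively.\<close>

lemma additive_hom_eq_on_lattice_ring:
  assumes X: "bounded_lattice X" and "group B"
    and \<phi>: "\<phi> \<in> hom (add_monoid (lattice_ring X)) B" and \<psi>: "\<psi> \<in> hom (add_monoid (lattice_ring X)) B"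
    and eq: "\<And>x. x \<in> carrier X \<Longrightarrow> \<phi> (lattice_class X x) = \<psi> (lattice_class X x)"
    and "a \<in> carrier (lattice_ring X)"
  shows "\<phi> a = \<psi> a"
proof -
  interpret R: cring "lattice_ring X" by (rule lattice_ring_cring[OF X])
  from X \<open>a \<in> carrier (lattice_ring X)\<close> show ?thesis
  proof (induction a rule: lattice_ring_induct)
    case (diff a b)
    then show ?case
      using additive_hom_diff[OF R.abelian_group_axioms \<open>group B\<close> \<phi>]
        additive_hom_diff[OF R.abelian_group_axioms \<open>group B\<close> \<psi>] by simp
  qed (rule eq)
qed

text \<open>Since the classes of lattice elements span the lattice ring additively and are closed under
  products, multiplicativity only has to be checked on them.\<close>

lemma lattice_rep_ring_hom:
  assumes X: "bounded_lattice X" and R: "cring R" and f: "lattice_rep X R f"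
  obtains \<phi> where "\<phi> \<in> ring_hom (lattice_ring X) R" "\<And>x. x \<in> carrier X \<Longrightarrow> \<phi> (lattice_class X x) = f x"
proof -
  interpret X: bounded_lattice X by (rule X)
  interpret R: cring R by (rule R)
  interpret S: cring "lattice_ring X" by (rule lattice_ring_cring[OF X])
  \<comment> \<open>With the identity as additive map, \<open>f\<close> itself is a measure with
    values in the additive group of \<open>R\<close>. Its extension is the candidate for the ring
    homomorphism.\<close>
  have "modular_measure X (add_monoid R) (\<lambda>x. f x)"
    using lattice_rep_modular_measure[OF X R f R.a_comm_group, of "\<lambda>x. x"] by (simp add: hom_def)
  from modular_measure_extends[OF X R.a_comm_group this]
  obtain \<phi> where \<phi>: "\<phi> \<in> hom (add_monoid (lattice_ring X)) (add_monoid R)"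
    and \<phi>f: "\<And>x. x \<in> carrier X \<Longrightarrow> \<phi> (lattice_class X x) = f x" by blast
  have cl: "\<phi> a \<in> carrier R" if "a \<in> carrier (lattice_ring X)" for a
    using \<phi> that by (auto simp: hom_def)
  have \<phi>_diff: "\<phi> (a \<ominus>\<^bsub>lattice_ring X\<^esub> b) = \<phi> a \<ominus>\<^bsub>R\<^esub> \<phi> b"
    if "a \<in> carrier (lattice_ring X)" "b \<in> carrier (lattice_ring X)" for a b
    using additive_hom_diff[OF S.abelian_group_axioms R.a_group \<phi> that] by (simp add: a_minus_def a_inv_def)
  note lc = lattice_class_closed[OF X]
  \<comment> \<open>The first factor is a class and the second is arbitrary; \<open>mult\<close>
    then frees the first one.\<close>
  have mult1: "\<phi> (lattice_class X x \<otimes>\<^bsub>lattice_ring X\<^esub> b) = f x \<otimes>\<^bsub>R\<^esub> \<phi> b"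
    if x: "x \<in> carrier X" and b: "b \<in> carrier (lattice_ring X)" for x b
    using X b
  proof (induction b rule: lattice_ring_induct)
    case (lattice_class y)
    then show ?case
      using x f \<phi>f by (simp add: lattice_class_meet[OF X, symmetric] lattice_rep_def)
  next
    case (diff a b)
    have "lattice_class X x \<otimes>\<^bsub>lattice_ring X\<^esub> (a \<ominus>\<^bsub>lattice_ring X\<^esub> b) =
        lattice_class X x \<otimes>\<^bsub>lattice_ring X\<^esub> a \<ominus>\<^bsub>lattice_ring X\<^esub> lattice_class X x \<otimes>\<^bsub>lattice_ring X\<^esub> b"
      using diff(1,2) lc[OF x] by algebra
    moreover have "f x \<otimes>\<^bsub>R\<^esub> (\<phi> a \<ominus>\<^bsub>R\<^esub> \<phi> b) = f x \<otimes>\<^bsub>R\<^esub> \<phi> a \<ominus>\<^bsub>R\<^esub> f x \<otimes>\<^bsub>R\<^esub> \<phi> b"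
      using cl[OF diff(1)] cl[OF diff(2)] cl[OF lc[OF x]] unfolding \<phi>f[OF x] by algebra
    ultimately show ?case using diff x lc by (simp add: \<phi>_diff)
  qed
  have mult: "\<phi> (a \<otimes>\<^bsub>lattice_ring X\<^esub> b) = \<phi> a \<otimes>\<^bsub>R\<^esub> \<phi> b"
    if a: "a \<in> carrier (lattice_ring X)" and b: "b \<in> carrier (lattice_ring X)" for a b
    using X a
  proof (induction a rule: lattice_ring_induct)
    case (lattice_class x)
    then show ?case using mult1[OF _ b] \<phi>f by simp
  next
    case (diff a a')
    have "(a \<ominus>\<^bsub>lattice_ring X\<^esub> a') \<otimes>\<^bsub>lattice_ring X\<^esub> b =
        a \<otimes>\<^bsub>lattice_ring X\<^esub> b \<ominus>\<^bsub>lattice_ring X\<^esub> a' \<otimes>\<^bsub>lattice_ring X\<^esub> b"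
      using diff(1,2) b by algebra
    moreover have "(\<phi> a \<ominus>\<^bsub>R\<^esub> \<phi> a') \<otimes>\<^bsub>R\<^esub> \<phi> b = \<phi> a \<otimes>\<^bsub>R\<^esub> \<phi> b \<ominus>\<^bsub>R\<^esub> \<phi> a' \<otimes>\<^bsub>R\<^esub> \<phi> b"
      using cl[OF diff(1)] cl[OF diff(2)] cl[OF b] by algebra
    ultimately show ?case using diff b by (simp add: \<phi>_diff)
  qed
  have "\<phi> \<in> ring_hom (lattice_ring X) R"
  proof (rule ring_hom_memI)
    show "\<phi> \<one>\<^bsub>lattice_ring X\<^esub> = \<one>\<^bsub>R\<^esub>"
      using \<phi>f[OF X.top_closed] f by (simp add: lattice_class_top[OF X] lattice_rep_def)
  qed (use \<phi> cl mult in \<open>auto simp: hom_def\<close>)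
  then show thesis using \<phi>f that by blast
qed

lemma ring_hom_additive: "\<phi> \<in> ring_hom R S \<Longrightarrow> \<phi> \<in> hom (add_monoid R) (add_monoid S)"
  by (auto simp: ring_hom_def hom_def)

subsection \<open>The Boolean envelope\<close>

context
  fixes X :: "('a, 'm) gorder_scheme"
  assumes X: "bounded_lattice X"
begin

interpretation X: bounded_lattice X by (rule X)
interpretation R: cring "lattice_ring X" by (rule lattice_ring_cring[OF X])
interpretation Y: bounded_lattice "boolean_envelope X" by (rule boolean_envelope_lattice(1)[OF X])
interpretation RY: cring "lattice_ring (boolean_envelope X)"
  by (rule lattice_ring_cring[OF boolean_envelope_lattice(1)[OF X]])

private lemmas env = boolean_envelope_lattice[OF X]

text \<open>The carrier is the intersection of all Boolean-closed sets of idempotents that contain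
  the classes, and its elements satisfying \<open>Q\<close> form one of these sets.\<close>

lemma boolean_envelope_induct [consumes 1, case_names lattice_class meet join complement]:
  assumes "y \<in> carrier (boolean_envelope X)"
    and "\<And>x. x \<in> carrier X \<Longrightarrow> Q (lattice_class X x)"
    and "\<And>a b. a \<in> carrier (boolean_envelope X) \<Longrightarrow> b \<in> carrier (boolean_envelope X) \<Longrightarrow> Q a \<Longrightarrow> Q b
      \<Longrightarrow> Q (a \<otimes>\<^bsub>lattice_ring X\<^esub> b)"
    and "\<And>a b. a \<in> carrier (boolean_envelope X) \<Longrightarrow> b \<in> carrier (boolean_envelope X) \<Longrightarrow> Q a \<Longrightarrow> Q b
      \<Longrightarrow> Q (a \<oplus>\<^bsub>lattice_ring X\<^esub> b \<ominus>\<^bsub>lattice_ring X\<^esub> a \<otimes>\<^bsub>lattice_ring X\<^esub> b)"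
    and "\<And>a. a \<in> carrier (boolean_envelope X) \<Longrightarrow> Q a \<Longrightarrow> Q (\<one>\<^bsub>lattice_ring X\<^esub> \<ominus>\<^bsub>lattice_ring X\<^esub> a)"
  shows "Q y"
proof -
  let ?A = "lattice_class X ` carrier X" and ?R = "lattice_ring X" and ?Y = "boolean_envelope X"
  have A: "?A \<subseteq> idempotents ?R" "?A \<noteq> {}"
    using lattice_class_idempotent[OF X] by auto
  let ?S = "{y \<in> carrier ?Y. Q y}"
  have cl: "bool_closed ?R (carrier ?Y)" and i: "carrier ?Y \<subseteq> idempotents ?R"
    using R.generated_bool_closed[OF A] R.generated_idempotent[OF A]
    by (simp_all add: boolean_envelope_def)
  have "bool_closed ?R ?S"
    using cl assms(3-5) by (auto simp: bool_closed_def)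
  moreover have "?A \<subseteq> ?S" using env(2) assms(2) by auto
  moreover have "?S \<subseteq> idempotents ?R" using i by auto
  moreover have "carrier ?Y = \<Inter>{S. ?A \<subseteq> S \<and> S \<subseteq> idempotents ?R \<and> bool_closed ?R S}"
    by (simp add: boolean_envelope_def generated_boolean_lattice_def)
  ultimately have "carrier ?Y \<subseteq> ?S" using Inter_lower[of ?S] by blast
  then show ?thesis using assms(1) by auto
qed

lemma boolean_envelope_closed:
  assumes "y \<in> carrier (boolean_envelope X)"
  shows "y \<in> carrier (lattice_ring X)" "y \<otimes>\<^bsub>lattice_ring X\<^esub> y = y"
    "\<one>\<^bsub>lattice_ring X\<^esub> \<ominus>\<^bsub>lattice_ring X\<^esub> y \<in> carrier (boolean_envelope X)"
proof -
  let ?A = "lattice_class X ` carrier X" and ?R = "lattice_ring X"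
  have A: "?A \<subseteq> idempotents ?R" "?A \<noteq> {}"
    using lattice_class_idempotent[OF X] by auto
  show "y \<in> carrier ?R" "y \<otimes>\<^bsub>?R\<^esub> y = y" "\<one>\<^bsub>?R\<^esub> \<ominus>\<^bsub>?R\<^esub> y \<in> carrier (boolean_envelope X)"
    using R.generated_carrier[OF A] R.generated_closed(3)[OF A] assms
    by (simp_all add: boolean_envelope_def)
qed

text \<open>The inclusion of the envelope into the ring of \<open>X\<close> serves twice: it induces
  the homomorphism from the ring of the envelope to the ring of \<open>X\<close>, and it lets
  additive maps restrict to measures on the envelope.\<close>

lemma lattice_rep_envelope: "lattice_rep (boolean_envelope X) (lattice_ring X) (\<lambda>y. y)"
  using env boolean_envelope_closed by (simp add: lattice_rep_def)

text \<open>The relations of the ideal do not mention complements. But \<open>y\<close> and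
  \<open>1 - y\<close> have meet \<open>\<bottom>\<close> and join \<open>\<top>\<close> in the
  envelope, so their classes have product 0 and sum 1.\<close>

lemma lattice_class_complement:
  assumes y: "y \<in> carrier (boolean_envelope X)"
  shows "lattice_class (boolean_envelope X) (\<one>\<^bsub>lattice_ring X\<^esub> \<ominus>\<^bsub>lattice_ring X\<^esub> y) =
    \<one>\<^bsub>lattice_ring (boolean_envelope X)\<^esub> \<ominus>\<^bsub>lattice_ring (boolean_envelope X)\<^esub> lattice_class (boolean_envelope X) y"
proof -
  let ?Y = "boolean_envelope X" and ?R = "lattice_ring X"
  let ?y' = "\<one>\<^bsub>?R\<^esub> \<ominus>\<^bsub>?R\<^esub> y"
  note yc = boolean_envelope_closed[OF y]
  have "y \<otimes>\<^bsub>?R\<^esub> ?y' = y \<ominus>\<^bsub>?R\<^esub> y \<otimes>\<^bsub>?R\<^esub> y" using yc(1) by algebra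
  also have "\<dots> = \<zero>\<^bsub>?R\<^esub>" unfolding yc(2) using yc(1) by algebra
  finally have prod: "y \<otimes>\<^bsub>?R\<^esub> ?y' = \<zero>\<^bsub>?R\<^esub>" .
  have m: "y \<sqinter>\<^bsub>?Y\<^esub> ?y' = \<bottom>\<^bsub>?Y\<^esub>" using env(3,5) y yc prod by simp
  have "y \<squnion>\<^bsub>?Y\<^esub> ?y' = y \<oplus>\<^bsub>?R\<^esub> ?y' \<ominus>\<^bsub>?R\<^esub> y \<otimes>\<^bsub>?R\<^esub> ?y'" using env(6) y yc by simp
  also have "\<dots> = y \<oplus>\<^bsub>?R\<^esub> ?y' \<ominus>\<^bsub>?R\<^esub> \<zero>\<^bsub>?R\<^esub>" unfolding prod ..
  also have "\<dots> = \<top>\<^bsub>?Y\<^esub>" unfolding env(4) using yc(1) by algebra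
  finally have j: "y \<squnion>\<^bsub>?Y\<^esub> ?y' = \<top>\<^bsub>?Y\<^esub>" .
  let ?Q = "lattice_ring ?Y" and ?c = "lattice_class ?Y y" and ?c' = "lattice_class ?Y ?y'"
  have c: "?c \<in> carrier ?Q" "?c' \<in> carrier ?Q"
    using lattice_class_closed[OF env(1)] y yc by auto
  have 0: "?c \<otimes>\<^bsub>?Q\<^esub> ?c' = \<zero>\<^bsub>?Q\<^esub>"
    using lattice_class_meet[OF env(1) y yc(3)] lattice_class_bottom[OF env(1)] m by simp
  have "\<one>\<^bsub>?Q\<^esub> = ?c \<oplus>\<^bsub>?Q\<^esub> ?c' \<ominus>\<^bsub>?Q\<^esub> ?c \<otimes>\<^bsub>?Q\<^esub> ?c'"
    using lattice_class_join[OF env(1) y yc(3)] lattice_class_top[OF env(1)] j by simp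
  also have "\<dots> = ?c \<oplus>\<^bsub>?Q\<^esub> ?c' \<ominus>\<^bsub>?Q\<^esub> \<zero>\<^bsub>?Q\<^esub>" unfolding 0 ..
  finally have "\<one>\<^bsub>?Q\<^esub> \<ominus>\<^bsub>?Q\<^esub> ?c = (?c \<oplus>\<^bsub>?Q\<^esub> ?c' \<ominus>\<^bsub>?Q\<^esub> \<zero>\<^bsub>?Q\<^esub>) \<ominus>\<^bsub>?Q\<^esub> ?c" by simp
  also have "\<dots> = ?c'" using c by algebra
  finally show ?thesis by simp
qed

text \<open>Since the operations of the envelope are those of idempotents in the ring of
  \<open>X\<close>, the class map is a homomorphism of bounded lattices from \<open>X\<close> to the
  envelope; a second class map makes it a representation in the ring of the envelope.\<close>

lemma lattice_rep_double_class:
  "lattice_rep X (lattice_ring (boolean_envelope X)) (\<lambda>x. lattice_class (boolean_envelope X) (lattice_class X x))"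
proof -
  let ?Y = "boolean_envelope X" and ?\<pi> = "lattice_class X"
  have c: "?\<pi> x \<in> carrier ?Y" if "x \<in> carrier X" for x using env(2) that by auto
  have "?\<pi> (x \<sqinter>\<^bsub>X\<^esub> y) = ?\<pi> x \<sqinter>\<^bsub>?Y\<^esub> ?\<pi> y" "?\<pi> (x \<squnion>\<^bsub>X\<^esub> y) = ?\<pi> x \<squnion>\<^bsub>?Y\<^esub> ?\<pi> y"
    if "x \<in> carrier X" "y \<in> carrier X" for x y
    using that c env(5,6) by (simp_all add: lattice_class_meet[OF X] lattice_class_join[OF X])
  moreover have "?\<pi> \<bottom>\<^bsub>X\<^esub> = \<bottom>\<^bsub>?Y\<^esub>" "?\<pi> \<top>\<^bsub>X\<^esub> = \<top>\<^bsub>?Y\<^esub>"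
    using env(3,4) by (simp_all add: lattice_class_bottom[OF X] lattice_class_top[OF X])
  ultimately show ?thesis
    using c lattice_class_closed[OF env(1)]
    by (simp add: lattice_rep_def lattice_class_meet[OF env(1)] lattice_class_join[OF env(1)]
        lattice_class_bottom[OF env(1)] lattice_class_top[OF env(1)])
qed

text \<open>The second property is recorded for \<open>pi_pullback_inj\<close>: through it a measure
  on the envelope becomes the restriction of an additive map on the ring of
  \<open>X\<close>.\<close>

lemma lattice_ring_envelope_iso:
  obtains \<psi> where "\<psi> \<in> ring_iso (lattice_ring X) (lattice_ring (boolean_envelope X))"
    "\<And>y. y \<in> carrier (boolean_envelope X) \<Longrightarrow> \<psi> y = lattice_class (boolean_envelope X) y"
proof -
  let ?Y = "boolean_envelope X" and ?R = "lattice_ring X"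
  let ?Q = "lattice_ring ?Y"
  from lattice_rep_ring_hom[OF X RY.is_cring lattice_rep_double_class]
  obtain \<psi> where \<psi>: "\<psi> \<in> ring_hom ?R ?Q"
    and \<psi>\<pi>: "\<And>x. x \<in> carrier X \<Longrightarrow> \<psi> (lattice_class X x) = lattice_class ?Y (lattice_class X x)" by blast
  from lattice_rep_ring_hom[OF env(1) R.is_cring lattice_rep_envelope]
  obtain \<theta> where \<theta>: "\<theta> \<in> ring_hom ?Q ?R"
    and \<theta>\<pi>: "\<And>y. y \<in> carrier ?Y \<Longrightarrow> \<theta> (lattice_class ?Y y) = y" by blast
  interpret \<psi>: ring_hom_cring ?R ?Q \<psi>
    using \<psi> by unfold_locales
  interpret \<theta>: ring_hom_cring ?Q ?R \<theta>
    using \<theta> by unfold_locales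
  have \<psi>_diff: "\<psi> (a \<ominus>\<^bsub>?R\<^esub> b) = \<psi> a \<ominus>\<^bsub>?Q\<^esub> \<psi> b" if "a \<in> carrier ?R" "b \<in> carrier ?R" for a b
    using that by (simp add: a_minus_def)
  have \<theta>_diff: "\<theta> (a \<ominus>\<^bsub>?Q\<^esub> b) = \<theta> a \<ominus>\<^bsub>?R\<^esub> \<theta> b" if "a \<in> carrier ?Q" "b \<in> carrier ?Q" for a b
    using that by (simp add: a_minus_def)
  \<comment> \<open>On classes of elements of \<open>X\<close> this is the choice of
    \<open>\<psi>\<close>. The Boolean operations propagate it, since \<open>\<psi>\<close> is a
    ring homomorphism and classes in the ring of the envelope obey the same formulas.\<close>
  have \<psi>Y: "\<psi> y = lattice_class ?Y y" if "y \<in> carrier ?Y" for y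
    using that
  proof (induction y rule: boolean_envelope_induct)
    case (lattice_class x)
    then show ?case by (rule \<psi>\<pi>)
  next
    case (meet a b)
    then show ?case
      using lattice_class_meet[OF env(1), of a b] env(5)[of a b] boolean_envelope_closed(1) by simp
  next
    case (join a b)
    then show ?case
      using lattice_class_join[OF env(1), of a b] env(6)[of a b] boolean_envelope_closed(1)
      by (simp add: \<psi>_diff)
  next
    case (complement a)
    then show ?case
      using lattice_class_complement[of a] boolean_envelope_closed(1) by (simp add: \<psi>_diff)
  qed
  have 1: "\<theta> (\<psi> a) = a" if "a \<in> carrier ?R" for a
    using X that
  proof (induction a rule: lattice_ring_induct)
    case (lattice_class x)
    then have "lattice_class X x \<in> carrier ?Y" using env(2) by blast
    then show ?case using lattice_class by (simp add: \<psi>\<pi> \<theta>\<pi>)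
  next
    case (diff a b)
    then show ?case by (simp add: \<psi>_diff \<theta>_diff)
  qed
  \<comment> \<open>The generators are now the classes of all elements of the envelope, not only of
    those coming from \<open>X\<close>; hence the need for \<open>\<psi>Y\<close>.\<close>
  have 2: "\<psi> (\<theta> b) = b" if "b \<in> carrier ?Q" for b
    using env(1) that
  proof (induction b rule: lattice_ring_induct)
    case (lattice_class y)
    then show ?case by (simp add: \<theta>\<pi> \<psi>Y)
  next
    case (diff a b)
    then show ?case by (simp add: \<psi>_diff \<theta>_diff)
  qed
  have "bij_betw \<psi> (carrier ?R) (carrier ?Q)"
    using 1 2 by (intro bij_betw_byWitness[where f' = \<theta>]) auto
  then have "\<psi> \<in> ring_iso ?R ?Q" using \<psi> by (simp add: ring_iso_def)
  then show thesis using \<psi>Y that by blast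
qed

section \<open>Pulling measures back from the envelope to the lattice\<close>

lemma pi_pullback_measure:
  assumes B: "comm_group B" and \<nu>: "\<nu> \<in> measures (boolean_envelope X) B"
  shows "pi_pullback X \<nu> \<in> measures X B"
proof -
  let ?Y = "boolean_envelope X"
  interpret B: comm_group B by (rule B)
  have "modular_measure ?Y B \<nu>" using \<nu> B.measures_iff[OF env(1)] by blast
  from modular_measure_extends[OF env(1) B this]
  obtain \<phi> where \<phi>: "\<phi> \<in> hom (add_monoid (lattice_ring ?Y)) B"
    and \<phi>\<nu>: "\<And>y. y \<in> carrier ?Y \<Longrightarrow> \<phi> (lattice_class ?Y y) = \<nu> y" by blast
  \<comment> \<open>The pullback of \<open>\<nu>\<close> is the additive extension
    \<open>\<phi>\<close> evaluated at double classes, which form a representation of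
    \<open>X\<close>.\<close>
  have "modular_measure X B (\<lambda>x. \<phi> (lattice_class ?Y (lattice_class X x)))"
    by (rule lattice_rep_modular_measure[OF X RY.is_cring lattice_rep_double_class B \<phi>])
  then have "modular_measure X B (pi_pullback X \<nu>)"
    using env(2) \<phi>\<nu> by (simp add: modular_measure_def pi_pullback_def compose_def Pi_def)
  then show ?thesis
    unfolding B.measures_iff[OF X] by (simp add: pi_pullback_def)
qed

text \<open>Two measures with the same pullback extend to additive maps on the ring of
  \<open>X\<close>. These agree on the classes of elements of \<open>X\<close>, hence on the whole
  ring, which contains the envelope.\<close>

lemma pi_pullback_inj:
  assumes B: "comm_group B"
  shows "inj_on (pi_pullback X) (measures (boolean_envelope X) B)"
proof (rule inj_onI)
  let ?Y = "boolean_envelope X" and ?R = "lattice_ring X"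
  let ?Q = "lattice_ring ?Y"
  interpret B: comm_group B by (rule B)
  obtain \<psi> where \<psi>: "\<psi> \<in> ring_iso ?R ?Q"
    and \<psi>Y: "\<And>y. y \<in> carrier ?Y \<Longrightarrow> \<psi> y = lattice_class ?Y y"
    using lattice_ring_envelope_iso by blast
  have \<psi>_hom: "\<psi> \<in> hom (add_monoid ?R) (add_monoid ?Q)"
    using \<psi> by (intro ring_hom_additive) (simp add: ring_iso_def)
  fix \<mu> \<nu> assume \<mu>: "\<mu> \<in> measures ?Y B" and \<nu>: "\<nu> \<in> measures ?Y B"
    and eq: "pi_pullback X \<mu> = pi_pullback X \<nu>"
  have ext: "\<exists>\<phi> \<in> hom (add_monoid ?R) B. \<forall>y\<in>carrier ?Y. \<phi> y = \<kappa> y" if "\<kappa> \<in> measures ?Y B" for \<kappa>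
  proof -
    have "modular_measure ?Y B \<kappa>" using that B.measures_iff[OF env(1)] by blast
    from modular_measure_extends[OF env(1) B this]
    obtain \<phi> where \<phi>: "\<phi> \<in> hom (add_monoid ?Q) B"
      and \<phi>\<kappa>: "\<And>y. y \<in> carrier ?Y \<Longrightarrow> \<phi> (lattice_class ?Y y) = \<kappa> y" by blast
    \<comment> \<open>Composing with \<open>\<psi>\<close> turns an extension along the class map of
      the envelope into one along its inclusion in the ring of \<open>X\<close>.\<close>
    have "\<phi> \<circ> \<psi> \<in> hom (add_monoid ?R) B"
      using \<psi>_hom \<phi> by (rule hom_compose)
    then show ?thesis using \<phi>\<kappa> \<psi>Y by (intro bexI[of _ "\<phi> \<circ> \<psi>"]) auto
  qed
  obtain \<phi> \<phi>' where \<phi>: "\<phi> \<in> hom (add_monoid ?R) B" "\<And>y. y \<in> carrier ?Y \<Longrightarrow> \<phi> y = \<mu> y"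
    and \<phi>': "\<phi>' \<in> hom (add_monoid ?R) B" "\<And>y. y \<in> carrier ?Y \<Longrightarrow> \<phi>' y = \<nu> y"
    using ext[OF \<mu>] ext[OF \<nu>] by blast
  have "\<phi> (lattice_class X x) = \<phi>' (lattice_class X x)" if "x \<in> carrier X" for x
  proof -
    have "lattice_class X x \<in> carrier ?Y" using env(2) that by auto
    then show ?thesis
      using fun_cong[OF eq, of x] that \<phi>(2) \<phi>'(2) by (simp add: pi_pullback_def compose_def)
  qed
  then have "\<phi> a = \<phi>' a" if "a \<in> carrier ?R" for a
    using additive_hom_eq_on_lattice_ring[OF X B.group_axioms \<phi>(1) \<phi>'(1)] that by blast
  then have "\<mu> y = \<nu> y" if "y \<in> carrier ?Y" for y
    using that \<phi>(2) \<phi>'(2) boolean_envelope_closed(1) by metis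
  moreover have "\<mu> \<in> extensional (carrier ?Y)" "\<nu> \<in> extensional (carrier ?Y)"
    using \<mu> \<nu> B.measures_iff[OF env(1)] by blast+
  ultimately show "\<mu> = \<nu>" using extensionalityI by blast
qed

text \<open>A measure on \<open>X\<close> extends to an additive map on the ring of
  \<open>X\<close>; the preimage is the restriction of this map to the envelope, which lies inside
  the ring.\<close>

lemma pi_pullback_surj:
  assumes B: "comm_group B" and \<nu>: "\<nu> \<in> measures X B"
  shows "\<nu> \<in> pi_pullback X ` measures (boolean_envelope X) B"
proof -
  let ?Y = "boolean_envelope X" and ?R = "lattice_ring X"
  interpret B: comm_group B by (rule B)
  have "modular_measure X B \<nu>" and ext: "\<nu> \<in> extensional (carrier X)"
    using \<nu> B.measures_iff[OF X] by blast+
  from modular_measure_extends[OF X B this(1)]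
  obtain \<phi> where \<phi>: "\<phi> \<in> hom (add_monoid ?R) B"
    and \<phi>\<nu>: "\<And>x. x \<in> carrier X \<Longrightarrow> \<phi> (lattice_class X x) = \<nu> x" by blast
  let ?\<mu> = "restrict \<phi> (carrier ?Y)"
  have "modular_measure ?Y B \<phi>"
    by (rule lattice_rep_modular_measure[OF env(1) R.is_cring lattice_rep_envelope B \<phi>])
  then have "modular_measure ?Y B ?\<mu>"
    by (simp add: modular_measure_def Pi_def)
  then have "?\<mu> \<in> measures ?Y B" unfolding B.measures_iff[OF env(1)] by simp
  moreover have "\<nu> = pi_pullback X ?\<mu>"
    using ext env(2) \<phi>\<nu> by (intro extensionalityI[of _ "carrier X"]) (auto simp: pi_pullback_def compose_def)
  ultimately show ?thesis by blast
qed

lemma pi_pullback_iso: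
  assumes B: "comm_group B"
  shows "pi_pullback X \<in> iso (measure_group (boolean_envelope X) B) (measure_group X B)"
proof -
  have "pi_pullback X \<in> hom (measure_group (boolean_envelope X) B) (measure_group X B)"
  proof (rule homI)
    fix \<mu> \<nu>
    show "pi_pullback X (\<mu> \<otimes>\<^bsub>measure_group (boolean_envelope X) B\<^esub> \<nu>) =
        pi_pullback X \<mu> \<otimes>\<^bsub>measure_group X B\<^esub> pi_pullback X \<nu>"
      using env(2) by (auto simp: measure_group_def pi_pullback_def compose_def restrict_def fun_eq_iff)
  qed (simp add: measure_group_def pi_pullback_measure[OF B])
  moreover have "bij_betw (pi_pullback X) (measures (boolean_envelope X) B) (measures X B)"
    using pi_pullback_inj[OF B] pi_pullback_surj[OF B] pi_pullback_measure[OF B]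
    by (auto simp: bij_betw_def)
  ultimately show ?thesis by (simp add: iso_def measure_group_def)
qed

text \<open>Associativity of composition; the restriction to the envelope is harmless because the
  class map takes its values there.\<close>

lemma pi_pullback_natural:
  "measure_map X f (pi_pullback X \<nu>) = pi_pullback X (measure_map (boolean_envelope X) f \<nu>)"
  using env(2) by (auto simp: measure_map_def pi_pullback_def compose_def restrict_def fun_eq_iff)

end

theorem theorem17:
  fixes X :: "('x, 'm) gorder_scheme"
  assumes "bounded_lattice X"
  defines "Y \<equiv> boolean_envelope X"
  shows "(\<forall>B :: ('b, 'n) monoid_scheme. comm_group B \<longrightarrow>
            pi_pullback X \<in> iso (measure_group Y B) (measure_group X B))
       \<and> (\<forall>(B :: ('b, 'n) monoid_scheme) (B' :: ('c, 'k) monoid_scheme) f.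
            comm_group B \<longrightarrow> comm_group B' \<longrightarrow> f \<in> hom B B' \<longrightarrow>
            (\<forall>\<nu> \<in> carrier (measure_group Y B).
               measure_map X f (pi_pullback X \<nu>) = pi_pullback X (measure_map Y f \<nu>)))
       \<and> lattice_ring X \<simeq> lattice_ring Y"
proof -
  have "ring_iso (lattice_ring X) (lattice_ring Y) \<noteq> {}"
    using lattice_ring_envelope_iso[OF assms(1)] unfolding Y_def by blast
  then show ?thesis
    by (simp add: Y_def is_ring_iso_def pi_pullback_iso[OF assms(1)] pi_pullback_natural[OF assms(1)])
qed

end
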